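(* Let $K$ be a field of characteristic $0$, let $X=\{x_1,\ldots,x_d\}$, and let $\Omega$ be a set of multilinear operations as in the context. Let $\delta$ be a linear locally nilpotent derivation of $K\{X\}_{\Omega}$ which, when acting on $KX$, has a Jordan normal form consisting of $k$ cells of size $n_1+1,\ldots,n_k+1$, respectively. Then the Hilbert series of the algebra of constants $K\{X\}_{\Omega}^{\delta}$ is given by $$H(K\{X\}_{\Omega}^{\delta},z)=2\int_0^1\cos^2(\pi u)\,H_{\delta}(K\{X\}_{\Omega},e^{2\pi iu},e^{-2\pi iu},z)\,du,$$ where $$H_{\delta}(K\{X\}_{\Omega},u_1,u_2,z)=H\Big(K\{x\}_{\Omega},\,z\sum_{r=1}^k s_{(n_r,0)}(u_1,u_2)\Big).$$ Equivalently, $$H(K\{X\}_{\Omega}^{\delta},z)=2\int_0^1\cos^2(\pi u)\,H\left(K\{x\}_{\Omega},\,z\sum_{i=1}^k\frac{\sin(2\pi (n_i+1)u)}{\sin(2\pi u)}\right)du.$$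
   Context: $\Omega=\bigcup_{n\ge 2}\Omega_n$, where $\Omega_n=\{\nu_{ni}\mid i=1,\ldots,p_n\}$ is a finite set (possibly empty) of $n$-ary operation symbols. For a set $X$, the free $\Omega$-magma $\{X\}_{\Omega}$ is the smallest set of formal expressions containing $X$ and containing $\nu_{ni}(u_1,\ldots,u_n)$ whenever $\nu_{ni}\in\Omega$ and $u_1,\ldots,u_n\in\{X\}_{\Omega}$. The (nonunitary) free $\Omega$-algebra $K\{X\}_{\Omega}$ is the $K$-vector space with basis $\{X\}_{\Omega}$, with the operations of $\Omega$ extended multilinearly. It is graded by $\deg(x_j)=1$ and $\deg\nu_{ni}(u_1,\ldots,u_n)=\sum_j\deg(u_j)$. For a graded subspace $V=\bigoplus_{k\ge1}V^{(k)}$ the Hilbert series is $H(V,t)=\sum_{k\ge 1}\dim(V^{(k)})t^k$. $K\{x\}_{\Omega}$ denotes the free $\Omega$-algebra on one generator $x$, and $H(K\{x\}_{\Omega},w)$ denotes the substitution of $w$ for $t$ in $H(K\{x\}_{\Omega},t)$. A linear operator $\delta$ on an $\Omega$-algebra $R$ is a derivation if $\delta(\nu_{ni}(v_1,\ldots,v_n))=\sum_{j=1}^n\nu_{ni}(v_1,\ldots,\delta(v_j),\ldots,v_n)$ for all $v_j\in R$, $\nu_{ni}\in\Omega$; it is locally nilpotent if for every $v\in R$ there is $k$ with $\delta^k(v)=0$. A derivation $\delta$ of $K\{X\}_{\Omega}$ is linear if $\delta(KX)\subseteq KX$, where $KX$ is the span of $X$; a linear locally nilpotent derivation thus acts on $KX$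 as a nilpotent operator. The algebra of constants is $K\{X\}_{\Omega}^{\delta}=\ker(\delta)$, with the grading inherited from $K\{X\}_{\Omega}$. The Schur function is $s_{(n,0)}(u_1,u_2)=u_1^n+u_1^{n-1}u_2+\cdots+u_2^n=\frac{u_1^{n+1}-u_2^{n+1}}{u_1-u_2}$. The right-hand sides are formal power series in $z$, integrated coefficientwise, and the quotient of sines is extended by continuity to the zeros of $\sin(2\pi u)$. *)

theory Defs
  imports
    "HOL-Analysis.Analysis"
    "HOL-Library.Poly_Mapping"
    "Jordan_Normal_Form.Jordan_Normal_Form"
begin

unbundle no vec_syntax

text \<open>\<^term>\<open>Op n i us\<close> stands for the expression formed with the \<open>i\<close>-th operation symbol of
  arity \<open>n\<close>, and \<^term>\<open>Gen j\<close> for the generator \<open>x\<^sub>j\<close>.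
  The signature is given by \<open>p\<close>: there are \<open>p n\<close> operation symbols of arity \<open>n\<close>, for \<open>n \<ge> 2\<close>;
  the values \<open>p 0\<close> and \<open>p 1\<close> are ignored.\<close>

datatype expr = Gen nat | Op nat nat "expr list"

definition symbols :: "(nat \<Rightarrow> nat) \<Rightarrow> (nat \<times> nat) set" where
  "symbols p = {(n, i). n \<ge> 2 \<and> i \<in> {1..p n}}"

inductive_set magma :: "(nat \<Rightarrow> nat) \<Rightarrow> nat \<Rightarrow> expr set" for p d where
  gen: "j \<in> {1..d} \<Longrightarrow> Gen j \<in> magma p d"
| op: "(n, i) \<in> symbols p \<Longrightarrow> length us = n \<Longrightarrow> \<forall>u\<in>set us. u \<in> magma p d \<Longrightarrow> Op n i us \<in> magma p d"

fun deg :: "expr \<Rightarrow> nat" where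
  "deg (Gen j) = 1"
| "deg (Op n i us) = sum_list (map deg us)"


definition scale :: "'k::field \<Rightarrow> ('b \<Rightarrow>\<^sub>0 'k) \<Rightarrow> ('b \<Rightarrow>\<^sub>0 'k)" where
  "scale c v = Poly_Mapping.map ((*) c) v"

lemma lookup_scale [simp]: "Poly_Mapping.lookup (scale c v) b = c * Poly_Mapping.lookup v b"
  unfolding scale_def by transfer (simp add: when_def)

global_interpretation kspace: vector_space "scale :: 'k::field \<Rightarrow> ('b \<Rightarrow>\<^sub>0 'k) \<Rightarrow> _"
  by unfold_locales (auto intro!: poly_mapping_eqI simp: lookup_add algebra_simps)

definition gen :: "nat \<Rightarrow> (expr \<Rightarrow>\<^sub>0 'k::field)" where
  "gen j = Poly_Mapping.single (Gen j) 1"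

definition free_algebra :: "(nat \<Rightarrow> nat) \<Rightarrow> nat \<Rightarrow> (expr \<Rightarrow>\<^sub>0 'k::field) set" where
  "free_algebra p d = {v. Poly_Mapping.keys v \<subseteq> magma p d}"

text \<open>The multilinear extension of the operation \<open>\<nu>\<^sub>n\<^sub>i\<close> from the basis of expressions:
  the sum runs over all ways of choosing one basis expression from the support of each argument.\<close>

definition operation :: "nat \<Rightarrow> nat \<Rightarrow> (expr \<Rightarrow>\<^sub>0 'k::field) list \<Rightarrow> (expr \<Rightarrow>\<^sub>0 'k)" where
  "operation n i vs =
     (\<Sum>us\<in>listset (map Poly_Mapping.keys vs).
        Poly_Mapping.single (Op n i us) (prod_list (map2 Poly_Mapping.lookup vs us)))"


text \<open>Operators on the free algebra are total functions of which only the values on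
  \<^const>\<open>free_algebra\<close> matter.\<close>

definition linear_operator_on :: "('b \<Rightarrow>\<^sub>0 'k::field) set \<Rightarrow> (('b \<Rightarrow>\<^sub>0 'k) \<Rightarrow> ('b \<Rightarrow>\<^sub>0 'k)) \<Rightarrow> bool" where
  "linear_operator_on A f \<longleftrightarrow>
     f ` A \<subseteq> A \<and>
     (\<forall>v\<in>A. \<forall>w\<in>A. f (v + w) = f v + f w) \<and>
     (\<forall>c. \<forall>v\<in>A. f (scale c v) = scale c (f v))"

definition derivation ::
  "(nat \<Rightarrow> nat) \<Rightarrow> nat \<Rightarrow> ((expr \<Rightarrow>\<^sub>0 'k::field) \<Rightarrow> (expr \<Rightarrow>\<^sub>0 'k)) \<Rightarrow> bool" where
  "derivation p d \<delta> \<longleftrightarrow>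
     linear_operator_on (free_algebra p d) \<delta> \<and>
     (\<forall>(n, i)\<in>symbols p. \<forall>vs. length vs = n \<and> set vs \<subseteq> free_algebra p d \<longrightarrow>
        \<delta> (operation n i vs) = (\<Sum>j<n. operation n i (vs[j := \<delta> (vs ! j)])))"

definition locally_nilpotent ::
  "(nat \<Rightarrow> nat) \<Rightarrow> nat \<Rightarrow> ((expr \<Rightarrow>\<^sub>0 'k::field) \<Rightarrow> (expr \<Rightarrow>\<^sub>0 'k)) \<Rightarrow> bool" where
  "locally_nilpotent p d \<delta> \<longleftrightarrow> (\<forall>v\<in>free_algebra p d. \<exists>k. (\<delta> ^^ k) v = 0)"

definition KX :: "nat \<Rightarrow> (expr \<Rightarrow>\<^sub>0 'k::field) set" where
  "KX d = kspace.span (gen ` {1..d})"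

definition linear_derivation ::
  "(nat \<Rightarrow> nat) \<Rightarrow> nat \<Rightarrow> ((expr \<Rightarrow>\<^sub>0 'k::field) \<Rightarrow> (expr \<Rightarrow>\<^sub>0 'k)) \<Rightarrow> bool" where
  "linear_derivation p d \<delta> \<longleftrightarrow> derivation p d \<delta> \<and> \<delta> ` KX d \<subseteq> KX d"

definition constants ::
  "(nat \<Rightarrow> nat) \<Rightarrow> nat \<Rightarrow> ((expr \<Rightarrow>\<^sub>0 'k::field) \<Rightarrow> (expr \<Rightarrow>\<^sub>0 'k)) \<Rightarrow> (expr \<Rightarrow>\<^sub>0 'k) set" where
  "constants p d \<delta> = {v \<in> free_algebra p d. \<delta> v = 0}"

text \<open>The matrix of the restriction of \<open>\<delta>\<close> to \<open>KX\<close> in the basis \<open>x\<^sub>1, \<dots>, x\<^sub>d\<close>; its columns are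
  the coordinates of the images, and its indices start at 0.\<close>

definition matrix_on_KX :: "nat \<Rightarrow> ((expr \<Rightarrow>\<^sub>0 'k::field) \<Rightarrow> (expr \<Rightarrow>\<^sub>0 'k)) \<Rightarrow> 'k mat" where
  "matrix_on_KX d \<delta> = Matrix.mat d d (\<lambda>(a, b). Poly_Mapping.lookup (\<delta> (gen (Suc b))) (Gen (Suc a)))"

text \<open>Only the sizes of the cells are prescribed; the eigenvalues are not, although for a
  nilpotent operator they are all 0.\<close>

definition has_jordan_cells :: "'k::field mat \<Rightarrow> nat list \<Rightarrow> bool" where
  "has_jordan_cells A sizes \<longleftrightarrow> (\<exists>n_as. jordan_nf A n_as \<and> map fst n_as = sizes)"


definition homogeneous :: "nat \<Rightarrow> (expr \<Rightarrow>\<^sub>0 'k::field) set" where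
  "homogeneous m = {v. \<forall>u\<in>Poly_Mapping.keys v. deg u = m}"

text \<open>The coefficient ring of the series is left open, since the Hilbert series is used both as
  a real and as a complex power series.\<close>

definition hilbert_series :: "(expr \<Rightarrow>\<^sub>0 'k::field) set \<Rightarrow> 'a::semiring_1 fps" where
  "hilbert_series V =
     Abs_fps (\<lambda>m. if m \<ge> 1 then of_nat (kspace.dim (V \<inter> homogeneous m)) else 0)"

definition schur :: "nat \<Rightarrow> 'a::comm_semiring_1 \<Rightarrow> 'a \<Rightarrow> 'a" where
  "schur n u\<^sub>1 u\<^sub>2 = (\<Sum>j\<le>n. u\<^sub>1 ^ (n - j) * u\<^sub>2 ^ j)"

text \<open>A power series in \<open>z\<close> depending on \<open>u\<^sub>1, u\<^sub>2\<close>. The first argument fixes the field over which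
  the dimensions are taken.\<close>

definition H_delta ::
  "'k::field itself \<Rightarrow> (nat \<Rightarrow> nat) \<Rightarrow> nat \<Rightarrow> (nat \<Rightarrow> nat) \<Rightarrow> complex \<Rightarrow> complex \<Rightarrow> complex fps" where
  "H_delta _ p k n u\<^sub>1 u\<^sub>2 =
     fps_compose (hilbert_series (free_algebra p 1 :: (expr \<Rightarrow>\<^sub>0 'k) set))
       (fps_X * fps_const (\<Sum>r=1..k. schur (n r) u\<^sub>1 u\<^sub>2))"

definition sin_quotient :: "nat \<Rightarrow> real \<Rightarrow> real" where
  "sin_quotient m u =
     (if sin (2 * pi * u) \<noteq> 0 then sin (2 * pi * real (m + 1) * u) / sin (2 * pi * u)
      else Lim (at u) (\<lambda>v. sin (2 * pi * real (m + 1) * v) / sin (2 * pi * v)))"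

definition coeffwise_integral :: "(real \<Rightarrow> 'a::{real_normed_vector} fps) \<Rightarrow> 'a fps" where
  "coeffwise_integral F = Abs_fps (\<lambda>m. integral {0..1} (\<lambda>u. fps_nth (F u) m))"

end

theory Submission
  imports Defs
begin

text \<open>
  The formula holds because a nilpotent derivation acts on each homogeneous component as the
  raising operator of a representation of \<open>sl\<^sub>2\<close>, so that the dimension of its kernel can be read
  off from the weights alone.

  In a Jordan basis of \<open>KX\<close> the derivation \<open>\<delta>\<close> moves every basis vector one place down its cell.
  Give the vector in position \<open>q\<close> of a cell of size \<open>t + 1\<close> the weight \<open>t - 2 q\<close>. The derivation
  that moves vectors up the cells with suitable coefficients and the derivation that multiplies
  every generator by its weight form an \<open>sl\<^sub>2\<close>-triple with \<open>\<delta>\<close> on the generators; since commutators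
  of derivations are derivations, the relations hold on the whole free algebra. Replacing the
  generators \<open>x\<^sub>j\<close> by the Jordan basis is an automorphism of the free algebra, so it is enough to
  treat the derivation that moves the generators themselves (lemma \<open>jordan_basis\<close>).

  On a finite-dimensional space with such a triple, over a field of characteristic 0, the raising
  operator is injective on negative weights and reaches every vector of positive weight. Hence the
  dimension of its kernel is the number of basis expressions of weight 0 plus the number of those
  of weight 1 (lemma \<open>dim_kernel\<close>), and the weights 1 and -1 occur equally often.

  An expression of degree \<open>m\<close> is a shape, that is, an expression of degree \<open>m\<close> in one generator,
  together with a free choice of \<open>m\<close> leaves. So the sum of \<open>q ^ weight\<close> over all expressions of
  degree \<open>m\<close> is the number of shapes times the \<open>m\<close>-th power of the sum over the generators
  (lemma \<open>weight_generating_function\<close>), and the latter is the sum of the Schur functions at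
  \<open>q\<close> and \<open>1 / q\<close>. For \<open>q = exp (2 \<pi> i u)\<close> the factor \<open>2 cos\<^sup>2 (\<pi> u) = 1 + (q + 1 / q) / 2\<close> makes
  the integral over \<open>u\<close> pick out the number of expressions of weight 0 plus the mean of the numbers
  of expressions of weight 1 and -1, which is the dimension of the space of constants. The formula
  with the quotients of sines has the same integrand away from three points.
\<close>

section \<open>Linear algebra in spaces of finitely supported functions\<close>

abbreviation unit_vec :: "'b \<Rightarrow> ('b \<Rightarrow>\<^sub>0 'k::field)" where
  "unit_vec u \<equiv> Poly_Mapping.single u 1"

abbreviation linear_map :: "(('b \<Rightarrow>\<^sub>0 'k::field) \<Rightarrow> ('c \<Rightarrow>\<^sub>0 'k)) \<Rightarrow> bool" where
  "linear_map \<equiv> Vector_Spaces.linear scale scale"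

abbreviation supported :: "'b set \<Rightarrow> ('b \<Rightarrow>\<^sub>0 'k::field) set" where
  "supported C \<equiv> {v. Poly_Mapping.keys v \<subseteq> C}"

lemma linear_mapI:
  assumes "\<And>v w. f (v + w) = f v + f w" "\<And>c v. f (scale c v) = scale c (f v)"
  shows "linear_map f"
  by unfold_locales (use assms in auto)

lemma linear_map_hom: "linear_map f \<Longrightarrow> module_hom scale scale f"
  by (rule Vector_Spaces.linear.axioms(3))

lemma expand_in_units: "v = (\<Sum>u\<in>Poly_Mapping.keys v. scale (Poly_Mapping.lookup v u) (unit_vec u))"
proof (rule poly_mapping_eqI)
  fix x
  have "(\<Sum>u\<in>Poly_Mapping.keys v. Poly_Mapping.lookup v u * (1 when u = x)) =
      (\<Sum>u\<in>Poly_Mapping.keys v. if u = x then Poly_Mapping.lookup v u else 0)"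
    by (rule sum.cong) (auto simp: when_def)
  then show "Poly_Mapping.lookup v x =
      Poly_Mapping.lookup (\<Sum>u\<in>Poly_Mapping.keys v. scale (Poly_Mapping.lookup v u) (unit_vec u)) x"
    by (simp add: lookup_sum lookup_single sum.delta in_keys_iff)
qed

lemma linear_map_sum:
  assumes "linear_map f"
  shows "f (\<Sum>i\<in>I. scale (c i) (g i)) = (\<Sum>i\<in>I. scale (c i) (f (g i)))"
proof -
  interpret f: Vector_Spaces.linear scale scale f by (rule assms)
  show ?thesis by (simp add: f.sum f.scale)
qed

lemma linear_map_expand:
  "linear_map f \<Longrightarrow> f v = (\<Sum>u\<in>Poly_Mapping.keys v. scale (Poly_Mapping.lookup v u) (f (unit_vec u)))"
  by (subst expand_in_units[of v]) (rule linear_map_sum)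

text \<open>Linear maps need to agree only on the support of the argument. This is what allows the
  identities below, which hold on some basis expressions only.\<close>

lemma linear_map_eqI:
  assumes "linear_map f" "linear_map g"
    and "\<And>u. u \<in> Poly_Mapping.keys v \<Longrightarrow> f (unit_vec u) = g (unit_vec u)"
  shows "f v = g v"
  unfolding linear_map_expand[OF assms(1), of v] linear_map_expand[OF assms(2), of v]
  using assms(3) by (intro sum.cong) auto

lemma subspace_supported: "kspace.subspace (supported C :: ('b \<Rightarrow>\<^sub>0 'k::field) set)"
proof (rule kspace.subspaceI)
  fix x y :: "'b \<Rightarrow>\<^sub>0 'k" assume "x \<in> supported C" "y \<in> supported C"
  then show "x + y \<in> supported C" using keys_add[of x y] by auto
qed (auto simp: in_keys_iff subset_iff)

lemma supported_eq_span: "(supported C :: ('b \<Rightarrow>\<^sub>0 'k::field) set) = kspace.span (unit_vec ` C)"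
  (is "?S = ?T")
proof
  show "?S \<subseteq> ?T"
  proof
    fix v :: "'b \<Rightarrow>\<^sub>0 'k" assume v: "v \<in> supported C"
    have "(\<Sum>u\<in>Poly_Mapping.keys v. scale (Poly_Mapping.lookup v u) (unit_vec u))
        \<in> kspace.span (unit_vec ` C)"
      using v by (intro kspace.span_sum kspace.span_scale kspace.span_base) auto
    then show "v \<in> kspace.span (unit_vec ` C)" using expand_in_units[of v] by simp
  qed
  show "?T \<subseteq> ?S"
    by (rule kspace.span_minimal[OF _ subspace_supported]) auto
qed

lemma linear_map_supportedI:
  assumes "linear_map f" "kspace.subspace V" "\<And>u. u \<in> C \<Longrightarrow> f (unit_vec u) \<in> V" "v \<in> supported C"
  shows "f v \<in> V"
  unfolding linear_map_expand[OF assms(1), of v]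
  using assms by (intro kspace.subspace_sum kspace.subspace_scale) auto

lemma independent_units: "kspace.independent (unit_vec ` C :: ('b \<Rightarrow>\<^sub>0 'k::field) set)"
proof
  assume "kspace.dependent (unit_vec ` C :: ('b \<Rightarrow>\<^sub>0 'k) set)"
  then obtain u where u: "u \<in> C"
    and s: "(unit_vec u :: 'b \<Rightarrow>\<^sub>0 'k) \<in> kspace.span (unit_vec ` C - {unit_vec u})"
    unfolding kspace.dependent_def by auto
  have "unit_vec ` C - {unit_vec u :: 'b \<Rightarrow>\<^sub>0 'k} \<subseteq> unit_vec ` (C - {u})" by auto
  then have "(unit_vec u :: 'b \<Rightarrow>\<^sub>0 'k) \<in> supported (C - {u})"
    using s kspace.span_mono unfolding supported_eq_span by blast
  then show False by auto
qed

lemma card_units: "card (unit_vec ` C :: ('b \<Rightarrow>\<^sub>0 'k::field) set) = card C"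
proof (rule card_image, rule inj_onI)
  fix x y assume "(unit_vec x :: 'b \<Rightarrow>\<^sub>0 'k) = unit_vec y"
  then have "Poly_Mapping.keys (unit_vec x :: 'b \<Rightarrow>\<^sub>0 'k) = Poly_Mapping.keys (unit_vec y :: 'b \<Rightarrow>\<^sub>0 'k)"
    by (rule arg_cong)
  then show "x = y" by simp
qed

lemma dim_supported: "kspace.dim (supported C :: ('b \<Rightarrow>\<^sub>0 'k::field) set) = card C"
  by (simp add: supported_eq_span kspace.dim_eq_card_independent independent_units card_units)

lemma dim_injective_image:
  assumes f: "linear_map f" and V: "kspace.subspace V" and inj: "inj_on f V"
  shows "kspace.dim (f ` V) = kspace.dim V"
proof -
  obtain B where B: "B \<subseteq> V" "kspace.independent B" "V \<subseteq> kspace.span B" "card B = kspace.dim V"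
    by (rule kspace.basis_exists) blast
  have sp: "kspace.span B = V" using B V by (simp add: kspace.span_subspace)
  have "kspace.independent (f ` B)"
    using module_hom.independent_injective_image[of scale scale f B] f inj sp B by (simp add: linear_map_hom)
  moreover have "f ` V = kspace.span (f ` B)"
    using module_hom.span_image[of scale scale f B] f sp by (simp add: linear_map_hom)
  moreover have "card (f ` B) = card B" using inj B(1) by (metis card_image inj_on_subset)
  ultimately show ?thesis using B(4) by (simp add: kspace.dim_eq_card_independent)
qed

text \<open>The ambient space is infinite-dimensional, so the comparison of dimensions is made inside
  the span of finitely many basis vectors.\<close>

lemma subspace_eq_supported:
  assumes "finite C" "kspace.subspace V" "V \<subseteq> supported C" "kspace.dim V = card C"
  shows "V = (supported C :: ('b \<Rightarrow>\<^sub>0 'k::field) set)"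
proof (rule ccontr)
  assume "V \<noteq> supported C"
  then obtain x where x: "x \<in> supported C" "x \<notin> V" using assms(3) by blast
  obtain B where B: "B \<subseteq> V" "kspace.independent B" "V \<subseteq> kspace.span B" "card B = kspace.dim V"
    by (rule kspace.basis_exists) blast
  have sp: "kspace.span B = V" using B assms(2) by (simp add: kspace.span_subspace)
  have "kspace.independent (insert x B)" using B(2) x(2) sp by (simp add: kspace.independent_insertI)
  moreover have "insert x B \<subseteq> kspace.span (unit_vec ` C)" using x(1) B(1) assms(3) supported_eq_span by blast
  ultimately have "finite (insert x B)" "card (insert x B) \<le> card C"
    using kspace.independent_span_bound[of "unit_vec ` C" "insert x B"] assms(1) by (simp_all add: card_units)
  moreover have "x \<notin> B" using x B by auto
  ultimately show False using B(4) assms(4) by simp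
qed

text \<open>The kernel and a basis of it extend to a basis of the whole space; the map is injective on
  the span of the added vectors.\<close>

lemma rank_nullity_supported:
  fixes f :: "('b \<Rightarrow>\<^sub>0 'k::field) \<Rightarrow> ('c \<Rightarrow>\<^sub>0 'k)"
  assumes f: "linear_map f" and C: "finite C"
  shows "kspace.dim {v \<in> supported C. f v = 0} + kspace.dim (f ` supported C) = card C"
proof -
  let ?K = "{v \<in> supported C. f v = 0}"
  interpret f: Vector_Spaces.linear scale scale f by (rule f)
  have K: "kspace.subspace ?K"
  proof (rule kspace.subspaceI)
    show "0 \<in> ?K" by simp
    show "x + y \<in> ?K" if "x \<in> ?K" "y \<in> ?K" for x y
      using that kspace.subspace_add[OF subspace_supported, of x C y] by (simp add: f.add)
    show "scale c x \<in> ?K" if "x \<in> ?K" for c x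
      using that kspace.subspace_scale[OF subspace_supported, of x C c] by (simp add: f.scale)
  qed
  obtain B where B: "B \<subseteq> ?K" "kspace.independent B" "?K \<subseteq> kspace.span B" "card B = kspace.dim ?K"
    by (rule kspace.basis_exists) blast
  have spB: "kspace.span B = ?K" using B K by (simp add: kspace.span_subspace)
  have "B \<subseteq> supported C" using B(1) by blast
  then obtain D where D: "B \<subseteq> D" "D \<subseteq> supported C" "kspace.independent D" "supported C \<subseteq> kspace.span D"
    using kspace.maximal_independent_subset_extend[OF _ B(2), of "supported C"] by (metis (no_types, lifting))
  have spD: "kspace.span D = supported C" using D(2,4) subspace_supported by (rule kspace.span_subspace)
  have "finite D \<and> card D \<le> card C"
    using kspace.independent_span_bound[of "unit_vec ` C" D] D C
    by (simp add: card_units supported_eq_span)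
  then have finD: "finite D" by simp
  have cardD: "card D = card C"
    using kspace.dim_span_eq_card_independent[OF D(3)] spD dim_supported by metis
  have zero: "v = 0" if v: "v \<in> kspace.span (D - B)" "f v = 0" for v
  proof -
    have vD: "v \<in> kspace.span D" using v(1) kspace.span_mono[of "D - B" D] by auto
    have "v \<in> kspace.span B" using vD v(2) spB spD by auto
    then have "kspace.representation D v = kspace.representation B v"
      by (rule kspace.representation_extend[OF D(3) _ D(1)])
    moreover have "kspace.representation D v = kspace.representation (D - B) v"
      by (rule kspace.representation_extend[OF D(3) v(1)]) blast
    ultimately have "kspace.representation D v b = 0" for b
      using kspace.representation_ne_zero[of B v b] kspace.representation_ne_zero[of "D - B" v b]
      by (metis DiffD2)
    then show "v = 0"
      using kspace.sum_nonzero_representation_eq[OF D(3), of v] vD by simp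
  qed
  then have inj: "inj_on f (kspace.span (D - B))"
    by (simp add: f.inj_on_iff_eq_0 kspace.subspace_span)
  have "f ` supported C = kspace.span (f ` (D - B))"
  proof -
    have "kspace.span (f ` D) \<subseteq> kspace.span (f ` (D - B))"
    proof (rule kspace.span_minimal[OF _ kspace.subspace_span], safe)
      fix x assume x: "x \<in> D"
      show "f x \<in> kspace.span (f ` (D - B))"
      proof (cases "x \<in> B")
        case True
        then have "f x = 0" using B(1) by blast
        then show ?thesis using kspace.span_zero by simp
      next
        case False
        then show ?thesis using x by (auto intro: kspace.span_base)
      qed
    qed
    moreover have "kspace.span (f ` (D - B)) \<subseteq> kspace.span (f ` D)" by (intro kspace.span_mono) auto
    ultimately show ?thesis using f.span_image[of D] spD by auto
  qed
  moreover have "kspace.independent (f ` (D - B))"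
    using f.independent_injective_image[OF _ inj] D(3) kspace.independent_mono by blast
  moreover have "card (f ` (D - B)) = card (D - B)"
    using inj by (metis card_image inj_on_subset kspace.span_superset)
  ultimately have "kspace.dim (f ` supported C) = card D - card B"
    using finD D(1) by (simp add: kspace.dim_eq_card_independent card_Diff_subset finite_subset)
  then show ?thesis using B(4) cardD card_mono[OF finD D(1)] by simp
qed

section \<open>The kernel of the raising operator of an \<open>sl\<^sub>2\<close>-action\<close>

text \<open>The basis consists of weight vectors, and the third operator of the triple is diagonal in it;
  it therefore appears only through the function \<open>wt\<close>.\<close>

locale sl2_action =
  fixes e f :: "('b \<Rightarrow>\<^sub>0 'k::field_char_0) \<Rightarrow> ('b \<Rightarrow>\<^sub>0 'k)" and wt :: "'b \<Rightarrow> int" and B :: "'b set"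
  assumes finite_B: "finite B"
    and lin_e: "linear_map e" and lin_f: "linear_map f"
    and e_unit: "u \<in> B \<Longrightarrow> e (unit_vec u) \<in> supported {x \<in> B. wt x = wt u + 2}"
    and f_unit: "u \<in> B \<Longrightarrow> f (unit_vec u) \<in> supported {x \<in> B. wt x = wt u - 2}"
    and commutator: "u \<in> B \<Longrightarrow>
      e (f (unit_vec u)) - f (e (unit_vec u)) = scale (of_int (wt u)) (unit_vec u)"
begin

sublocale e: Vector_Spaces.linear scale scale e by (rule lin_e)
sublocale f: Vector_Spaces.linear scale scale f by (rule lin_f)

definition weight_space :: "int \<Rightarrow> ('b \<Rightarrow>\<^sub>0 'k) set" where
  "weight_space w = supported {x \<in> B. wt x = w}"

text \<open>Exchanging the two operators and negating the weights gives another action, which turns every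
  statement about raising into one about lowering.\<close>

lemma flip: "sl2_action f e (\<lambda>u. - wt u) B"
proof
  fix u assume u: "u \<in> B"
  show "f (unit_vec u) \<in> supported {x \<in> B. - wt x = - wt u + 2}"
    using f_unit[OF u] by (auto simp: subset_iff)
  show "e (unit_vec u) \<in> supported {x \<in> B. - wt x = - wt u - 2}"
    using e_unit[OF u] by (auto simp: subset_iff)
  show "f (e (unit_vec u)) - e (f (unit_vec u)) = scale (of_int (- wt u)) (unit_vec u)"
    using commutator[OF u] by (metis minus_diff_eq kspace.scale_minus_left of_int_minus)
qed (rule finite_B)

lemma subspace_weight_space: "kspace.subspace (weight_space w)"
  unfolding weight_space_def by (rule subspace_supported)

lemma e_weight_space: "v \<in> weight_space w \<Longrightarrow> e v \<in> weight_space (w + 2)"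
  by (rule linear_map_supportedI[OF lin_e subspace_weight_space, where C = "{x \<in> B. wt x = w}"])
     (use e_unit in \<open>auto simp: weight_space_def\<close>)

lemma f_weight_space: "v \<in> weight_space w \<Longrightarrow> f v \<in> weight_space (w - 2)"
  by (rule linear_map_supportedI[OF lin_f subspace_weight_space, where C = "{x \<in> B. wt x = w}"])
     (use f_unit in \<open>auto simp: weight_space_def\<close>)

lemma commutator_weight_space:
  assumes "v \<in> weight_space w"
  shows "e (f v) - f (e v) = scale (of_int w) v"
proof (rule linear_map_eqI[where f = "\<lambda>v. e (f v) - f (e v)"])
  show "linear_map (\<lambda>v. e (f v) - f (e v))"
    by (rule linear_mapI) (simp_all add: e.add f.add e.scale f.scale kspace.scale_right_diff_distrib)
  show "linear_map (scale (of_int w) :: ('b \<Rightarrow>\<^sub>0 'k) \<Rightarrow> _)"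
    by (rule linear_mapI) (simp_all add: kspace.scale_right_distrib mult.commute)
  fix u assume "u \<in> Poly_Mapping.keys v"
  then have "u \<in> B" "wt u = w" using assms by (auto simp: weight_space_def)
  then show "e (f (unit_vec u)) - f (e (unit_vec u)) = scale (of_int w) (unit_vec u)"
    using commutator by auto
qed

text \<open>If \<open>f e v = - c v\<close> then \<open>e v\<close> has weight \<open>w + 2\<close> and satisfies the same equation with
  \<open>c + w + 2\<close> in place of \<open>c\<close>. This constant stays positive, while the weight cannot grow for ever;
  so some \<open>e\<^sup>k v\<close> vanishes, and dividing by the constants, which are nonzero in characteristic 0,
  gives \<open>v = 0\<close>.\<close>

lemma no_negative_eigenvector:
  assumes "v \<in> weight_space w" "f (e v) = scale (- of_int c) v" "c > 0" "w > - 2"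
  shows "v = 0"
  using assms
proof (induction "nat (Max (wt ` B) + 1 - w)" arbitrary: v w c rule: less_induct)
  case less
  have ev: "e v \<in> weight_space (w + 2)" using e_weight_space less.prems(1) .
  have top: "w \<le> Max (wt ` B)" if "v \<noteq> 0"
  proof -
    have "Poly_Mapping.keys v \<noteq> {}" using that by simp
    then obtain u where "u \<in> Poly_Mapping.keys v" by blast
    then have "u \<in> B" "wt u = w" using less.prems(1) by (auto simp: weight_space_def)
    then show ?thesis using finite_B by (auto intro!: Max_ge)
  qed
  have "f (e (e v)) = e (f (e v)) - scale (of_int (w + 2)) (e v)"
    using commutator_weight_space[OF ev] by (simp add: algebra_simps)
  also have "\<dots> = scale (- of_int (c + w + 2)) (e v)"
    unfolding less.prems(2) e.scale by (simp add: kspace.scale_left_diff_distrib[symmetric] algebra_simps)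
  finally have "f (e (e v)) = scale (- of_int (c + w + 2)) (e v)" .
  then have "v = 0 \<or> e v = 0"
    using less.hyps[OF _ ev, of "c + w + 2"] top less.prems by (cases "v = 0") auto
  then show "v = 0" using less.prems(2,3) by auto
qed

lemma e_f_injective:
  assumes "v \<in> weight_space w" "w > 0" "e (f v) = 0"
  shows "v = 0"
proof (rule no_negative_eigenvector[OF assms(1), of w])
  show "f (e v) = scale (- of_int w) v"
    using commutator_weight_space[OF assms(1)] assms(3)
    by (metis diff_0 kspace.scale_minus_left minus_minus)
qed (use assms in auto)

lemma f_weight_space_injective: "v \<in> weight_space w \<Longrightarrow> w > 0 \<Longrightarrow> f v = 0 \<Longrightarrow> v = 0"
  using e_f_injective by (metis e.zero)

lemma e_weight_space_injective:
  assumes "v \<in> weight_space w" "w < 0" "e v = 0"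
  shows "v = 0"
proof -
  interpret flipped: sl2_action f e "\<lambda>u. - wt u" B by (rule flip)
  have "flipped.weight_space (- w) = weight_space w"
    by (simp add: flipped.weight_space_def weight_space_def)
  then show ?thesis using flipped.f_weight_space_injective[of v "- w"] assms by auto
qed

text \<open>Already \<open>e f\<close>, an endomorphism of a finite-dimensional space, is injective there.\<close>

lemma e_surjective_onto_positive:
  assumes "w > 0"
  shows "weight_space w \<subseteq> e ` weight_space (w - 2)"
proof -
  let ?C = "{x \<in> B. wt x = w}"
  have lin: "linear_map (\<lambda>v. e (f v))"
    by (rule linear_mapI) (simp_all add: e.add f.add e.scale f.scale)
  interpret ef: Vector_Spaces.linear scale scale "\<lambda>v. e (f v)" by (rule lin)
  have inj: "inj_on (\<lambda>v. e (f v)) (weight_space w)"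
    using e_f_injective assms subspace_weight_space by (subst ef.inj_on_iff_eq_0) auto
  have "(\<lambda>v. e (f v)) ` weight_space w = supported ?C"
  proof (rule subspace_eq_supported)
    show "finite ?C" using finite_B by simp
    show "kspace.subspace ((\<lambda>v. e (f v)) ` weight_space w)"
      by (rule ef.subspace_image[OF subspace_weight_space])
    show "(\<lambda>v. e (f v)) ` weight_space w \<subseteq> supported ?C"
      using e_weight_space[OF f_weight_space] unfolding weight_space_def by auto
    show "kspace.dim ((\<lambda>v. e (f v)) ` weight_space w) = card ?C"
      using dim_injective_image[OF lin subspace_weight_space inj] unfolding weight_space_def dim_supported .
  qed
  then have "weight_space w = (\<lambda>v. e (f v)) ` weight_space w" by (simp add: weight_space_def)
  also have "\<dots> \<subseteq> e ` weight_space (w - 2)" using f_weight_space by auto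
  finally show ?thesis .
qed

definition weight_part :: "int \<Rightarrow> ('b \<Rightarrow>\<^sub>0 'k) \<Rightarrow> ('b \<Rightarrow>\<^sub>0 'k)" where
  "weight_part w v = Poly_Mapping.mapp (\<lambda>u c. if wt u = w then c else 0) v"

lemma lookup_weight_part:
  "Poly_Mapping.lookup (weight_part w v) u = (if wt u = w then Poly_Mapping.lookup v u else 0)"
  by (simp add: weight_part_def lookup_mapp in_keys_iff when_def)

lemma linear_weight_part: "linear_map (weight_part w)"
  by (rule linear_mapI) (rule poly_mapping_eqI, simp add: lookup_weight_part lookup_add)+

lemma weight_part_eq_self: "v \<in> weight_space w \<Longrightarrow> weight_part w v = v"
  by (rule poly_mapping_eqI) (auto simp: lookup_weight_part weight_space_def in_keys_iff)

lemma weight_part_eq_zero: "v \<in> weight_space w' \<Longrightarrow> w \<noteq> w' \<Longrightarrow> weight_part w v = 0"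
  by (rule poly_mapping_eqI) (auto simp: lookup_weight_part weight_space_def in_keys_iff)

lemma weight_part_mem: "v \<in> supported B \<Longrightarrow> weight_part w v \<in> weight_space w"
  by (auto simp: weight_space_def in_keys_iff lookup_weight_part split: if_splits)

lemma e_weight_part:
  assumes "v \<in> supported B"
  shows "e (weight_part w v) = weight_part (w + 2) (e v)"
proof (rule linear_map_eqI[where f = "\<lambda>v. e (weight_part w v)"])
  interpret p: Vector_Spaces.linear scale scale "weight_part w0" for w0 by (rule linear_weight_part)
  show "linear_map (\<lambda>v. e (weight_part w v))" "linear_map (\<lambda>v. weight_part (w + 2) (e v))"
    by (rule linear_mapI; simp add: e.add p.add e.scale p.scale)+
  fix u assume "u \<in> Poly_Mapping.keys v"
  then have u: "unit_vec u \<in> weight_space (wt u)" using assms by (auto simp: weight_space_def)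
  show "e (weight_part w (unit_vec u)) = weight_part (w + 2) (e (unit_vec u))"
    by (cases "w = wt u")
       (use u e_weight_space[OF u] in \<open>auto simp: weight_part_eq_self weight_part_eq_zero\<close>)
qed

text \<open>The kernel of \<open>e\<close> is graded, and \<open>e\<close> is injective on each space of negative weight.\<close>

lemma kernel_nonnegative:
  assumes "v \<in> supported B" "e v = 0"
  shows "v \<in> supported {x \<in> B. wt x \<ge> 0}"
proof (safe)
  fix u assume u: "u \<in> Poly_Mapping.keys v"
  then show "u \<in> B" using assms(1) by auto
  show "wt u \<ge> 0"
  proof (rule ccontr)
    assume "\<not> wt u \<ge> 0"
    moreover have "e (weight_part (wt u) v) = 0"
      using e_weight_part[OF assms(1)] assms(2) linear_weight_part
      by (metis linear_map_hom module_hom.zero)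
    ultimately have "weight_part (wt u) v = 0"
      using e_weight_space_injective[OF weight_part_mem[OF assms(1)]] by simp
    then have "Poly_Mapping.lookup v u = 0" using lookup_weight_part[of "wt u" v u] by simp
    then show False using u by (simp add: in_keys_iff)
  qed
qed

lemma e_image_nonnegative:
  "e ` supported {x \<in> B. wt x \<ge> 0} = supported {x \<in> B. wt x \<ge> 2}" (is "e ` supported ?P = supported ?Q")
proof
  show "e ` supported ?P \<subseteq> supported ?Q"
  proof
    fix y assume "y \<in> e ` supported ?P"
    then obtain v where v: "v \<in> supported ?P" and y: "y = e v" by blast
    show "y \<in> supported ?Q" unfolding y
    proof (rule linear_map_supportedI[OF lin_e subspace_supported _ v])
      fix u assume "u \<in> ?P"
      then show "e (unit_vec u) \<in> supported ?Q" using e_unit[of u] by auto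
    qed
  qed
  have "kspace.span (unit_vec ` ?Q) \<subseteq> e ` supported ?P"
  proof (rule kspace.span_minimal)
    show "kspace.subspace (e ` supported ?P)" by (rule e.subspace_image[OF subspace_supported])
    show "unit_vec ` ?Q \<subseteq> e ` supported ?P"
    proof safe
      fix x assume x: "x \<in> B" "wt x \<ge> 2"
      then have "unit_vec x \<in> e ` weight_space (wt x - 2)"
        using e_surjective_onto_positive[of "wt x"] by (auto simp: weight_space_def)
      moreover have "weight_space (wt x - 2) \<subseteq> supported ?P" using x by (auto simp: weight_space_def)
      ultimately show "unit_vec x \<in> e ` supported ?P" by blast
    qed
  qed
  then show "supported ?Q \<subseteq> e ` supported ?P" by (simp add: supported_eq_span)
qed

text \<open>By the two preceding lemmas the kernel is that of a surjection from the weights \<open>\<ge> 0\<close> onto the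
  weights \<open>\<ge> 2\<close>, so its dimension is the difference of the two.\<close>

lemma dim_kernel:
  "kspace.dim {v \<in> supported B. e v = 0} = card {x \<in> B. wt x = 0} + card {x \<in> B. wt x = 1}"
proof -
  let ?P = "{x \<in> B. wt x \<ge> 0}" and ?Q = "{x \<in> B. wt x \<ge> 2}"
  have "{v \<in> supported B. e v = 0} = {v \<in> supported ?P. e v = 0}"
    using kernel_nonnegative by auto
  moreover have "kspace.dim {v \<in> supported ?P. e v = 0} + card ?Q = card ?P"
    using rank_nullity_supported[OF lin_e, of ?P] finite_B
    unfolding e_image_nonnegative dim_supported by simp
  moreover have "card ?P = card ?Q + card {x \<in> B. wt x = 0} + card {x \<in> B. wt x = 1}"
  proof -
    have "?P = ?Q \<union> {x \<in> B. wt x = 0} \<union> {x \<in> B. wt x = 1}" by auto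
    then show ?thesis using finite_B by (simp add: card_Un_disjoint disjoint_iff)
  qed
  ultimately show ?thesis by simp
qed

lemma card_weight_one_le: "card {x \<in> B. wt x = 1} \<le> card {x \<in> B. wt x = - 1}"
proof -
  have inj: "inj_on f (weight_space 1)"
    using f_weight_space_injective subspace_weight_space by (subst f.inj_on_iff_eq_0) auto
  have "kspace.dim (f ` weight_space 1) = card {x \<in> B. wt x = 1}"
    using dim_injective_image[OF lin_f subspace_weight_space inj] unfolding weight_space_def dim_supported .
  moreover have "f ` weight_space 1 \<subseteq> kspace.span (unit_vec ` {x \<in> B. wt x = - 1})"
    using f_weight_space[of _ 1] unfolding weight_space_def supported_eq_span[symmetric] by auto
  ultimately show ?thesis
    using kspace.dim_le_card[of "f ` weight_space 1" "unit_vec ` {x \<in> B. wt x = - 1}"] finite_B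
    by (simp add: card_units)
qed

lemma card_weight_minus_one: "card {x \<in> B. wt x = - 1} = card {x \<in> B. wt x = 1}"
proof -
  interpret flipped: sl2_action f e "\<lambda>u. - wt u" B by (rule flip)
  have *: "- wt x = 1 \<longleftrightarrow> wt x = - 1" "- wt x = - 1 \<longleftrightarrow> wt x = 1" for x by auto
  show ?thesis using card_weight_one_le flipped.card_weight_one_le unfolding * by simp
qed

end

section \<open>Multilinearity of the operations\<close>

definition linear_extension :: "('b \<Rightarrow> ('c \<Rightarrow>\<^sub>0 'k::field)) \<Rightarrow> ('b \<Rightarrow>\<^sub>0 'k) \<Rightarrow> ('c \<Rightarrow>\<^sub>0 'k)" where
  "linear_extension g v = (\<Sum>u\<in>Poly_Mapping.keys v. scale (Poly_Mapping.lookup v u) (g u))"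

lemma linear_extension_superset:
  assumes "finite S" "Poly_Mapping.keys v \<subseteq> S"
  shows "linear_extension g v = (\<Sum>u\<in>S. scale (Poly_Mapping.lookup v u) (g u))"
  unfolding linear_extension_def using assms
  by (intro sum.mono_neutral_left) (auto simp: in_keys_iff)

lemma linear_linear_extension:
  "linear_map (linear_extension g :: ('b \<Rightarrow>\<^sub>0 'k::field) \<Rightarrow> ('c \<Rightarrow>\<^sub>0 'k))"
proof (rule linear_mapI)
  fix v w :: "'b \<Rightarrow>\<^sub>0 'k" and c
  let ?S = "Poly_Mapping.keys v \<union> Poly_Mapping.keys w"
  show "linear_extension g (v + w) = linear_extension g v + linear_extension g w"
    using keys_add[of v w]
    by (simp add: linear_extension_superset[of ?S] lookup_add kspace.scale_left_distrib sum.distrib)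
  have "Poly_Mapping.keys (scale c v) \<subseteq> Poly_Mapping.keys v"
    by (auto simp: in_keys_iff)
  then show "linear_extension g (scale c v) = scale c (linear_extension g v)"
    by (simp add: linear_extension_superset[of "Poly_Mapping.keys v"] kspace.scale_sum_right)
qed

lemma linear_extension_unit [simp]: "linear_extension g (unit_vec u) = g u"
  by (simp add: linear_extension_def)

lemma linear_extension_units [simp]: "linear_extension unit_vec v = v"
  using expand_in_units[of v] by (simp add: linear_extension_def)

lemma single_eq_scale: "Poly_Mapping.single u c = scale c (unit_vec u)"
  by (rule poly_mapping_eqI) (simp add: lookup_single when_def)

lemma in_listset_iff:
  "xs \<in> listset As \<longleftrightarrow> length xs = length As \<and> (\<forall>j<length As. xs ! j \<in> As ! j)"
proof (induction As arbitrary: xs)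
  case (Cons A As)
  then show ?case by (cases xs) (auto simp: set_Cons_def All_less_Suc2)
qed simp

lemma finite_listset: "(\<And>A. A \<in> set As \<Longrightarrow> finite A) \<Longrightarrow> finite (listset As)"
proof (induction As)
  case (Cons A As)
  have "set_Cons A (listset As) = (\<lambda>(x, xs). x # xs) ` (A \<times> listset As)"
    by (auto simp: set_Cons_def)
  then show ?case using Cons by simp
qed simp

text \<open>The distributive law, with the choices of one factor from each sum recorded as a list. It is
  behind both the multilinearity of the operations and the count of expressions by weight.\<close>

lemma sum_listset_prod:
  fixes h :: "nat \<Rightarrow> 'a \<Rightarrow> 'r::comm_semiring_1"
  shows "(\<Sum>xs\<in>listset As. \<Prod>j<length As. h j (xs ! j)) = (\<Prod>j<length As. \<Sum>x\<in>As ! j. h j x)"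
proof (induction As arbitrary: h)
  case (Cons A As)
  have "(\<Sum>xs\<in>listset (A # As). \<Prod>j<length (A # As). h j (xs ! j)) =
      (\<Sum>(x, xs)\<in>A \<times> listset As. h 0 x * (\<Prod>j<length As. h (Suc j) (xs ! j)))"
  proof -
    have *: "listset (A # As) = (\<lambda>(x, xs). x # xs) ` (A \<times> listset As)"
      by (auto simp: set_Cons_def)
    have "inj_on (\<lambda>(x, xs). x # xs) (A \<times> listset As)" by (auto simp: inj_on_def)
    then show ?thesis unfolding *
      by (subst sum.reindex) (auto simp: prod.lessThan_Suc_shift simp del: prod.lessThan_Suc intro!: sum.cong)
  qed
  also have "\<dots> = (\<Sum>x\<in>A. h 0 x) * (\<Sum>xs\<in>listset As. \<Prod>j<length As. h (Suc j) (xs ! j))"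
    by (simp add: sum.cartesian_product[symmetric] sum_product)
  also have "\<dots> = (\<Prod>j<length (A # As). \<Sum>x\<in>(A # As) ! j. h j x)"
    using Cons.IH[of "\<lambda>j. h (Suc j)"] by (simp add: prod.lessThan_Suc_shift del: prod.lessThan_Suc)
  finally show ?case .
qed simp

text \<open>This describes an operation by coordinates, free of the supports that occur in its definition;
  linearity in each argument can be read off.\<close>

lemma lookup_operation:
  "Poly_Mapping.lookup (operation n i vs) x =
     (case x of Gen j \<Rightarrow> 0
      | Op n' i' us \<Rightarrow> if n' = n \<and> i' = i \<and> length us = length vs
          then \<Prod>j<length vs. Poly_Mapping.lookup (vs ! j) (us ! j) else 0)"
proof -
  define c where "c us = prod_list (map2 Poly_Mapping.lookup vs us)" for us
  have c: "c us = (\<Prod>j<length vs. Poly_Mapping.lookup (vs ! j) (us ! j))" if "length us = length vs" for us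
    using that by (simp add: c_def prod.list_conv_set_nth atLeast0LessThan)
  let ?L = "listset (map Poly_Mapping.keys vs)"
  have fin: "finite ?L" by (rule finite_listset) auto
  have "Poly_Mapping.lookup (operation n i vs) x = (\<Sum>us\<in>?L. c us when Op n i us = x)"
    by (simp add: operation_def lookup_sum lookup_single c_def)
  also have "\<dots> = (case x of Gen j \<Rightarrow> 0
      | Op n' i' us \<Rightarrow> if n' = n \<and> i' = i \<and> us \<in> ?L then c us else 0)"
  proof (cases x)
    case (Op n' i' us)
    have "(\<Sum>us'\<in>?L. c us' when Op n i us' = x) =
        (\<Sum>us'\<in>?L. if us' = us then (if n' = n \<and> i' = i then c us else 0) else 0)"
      using Op by (intro sum.cong) (auto simp: when_def)
    then show ?thesis using Op fin by (simp add: sum.delta)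
  qed simp
  also have "\<dots> = (case x of Gen j \<Rightarrow> 0
      | Op n' i' us \<Rightarrow> if n' = n \<and> i' = i \<and> length us = length vs
          then \<Prod>j<length vs. Poly_Mapping.lookup (vs ! j) (us ! j) else 0)"
  proof (cases x)
    case (Op n' i' us)
    have "(\<Prod>j<length vs. Poly_Mapping.lookup (vs ! j) (us ! j)) = 0"
      if "length us = length vs" "us \<notin> ?L"
      using that by (auto simp: in_listset_iff in_keys_iff)
    moreover have "length us = length vs" if "us \<in> ?L" using that by (simp add: in_listset_iff)
    ultimately show ?thesis using Op c[of us] by auto
  qed simp
  finally show ?thesis .
qed

lemma operation_units: "operation n i (map unit_vec us) = unit_vec (Op n i us)"
proof (rule poly_mapping_eqI)
  fix x
  have "(\<Prod>j<length us. 1 when us ! j = ws ! j) = ((1 when us = ws) :: 'a)"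
    if len: "length ws = length us" for ws
  proof (cases "us = ws")
    case False
    then obtain j where "j < length us" "us ! j \<noteq> ws ! j" using len by (metis nth_equalityI)
    then show ?thesis using False by (auto simp: when_def)
  qed simp
  then show "Poly_Mapping.lookup (operation n i (map unit_vec us)) x =
      (Poly_Mapping.lookup (unit_vec (Op n i us)) x :: 'a)"
    by (cases x) (auto simp: lookup_operation lookup_single when_def)
qed

lemma linear_operation:
  assumes "j < length vs"
  shows "linear_map (\<lambda>v. operation n i (vs[j := v]))"
proof -
  have upd: "Poly_Mapping.lookup (operation n i (vs[j := v])) x =
      (case x of Gen _ \<Rightarrow> 0
      | Op n' i' us \<Rightarrow> if n' = n \<and> i' = i \<and> length us = length vs
          then Poly_Mapping.lookup v (us ! j) *
            (\<Prod>k\<in>{..<length vs} - {j}. Poly_Mapping.lookup (vs ! k) (us ! k)) else 0)" for v x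
  proof -
    have "(\<Prod>k<length vs. Poly_Mapping.lookup (vs[j := v] ! k) (us ! k)) =
        Poly_Mapping.lookup v (us ! j) *
        (\<Prod>k\<in>{..<length vs} - {j}. Poly_Mapping.lookup (vs ! k) (us ! k))" for us
      using assms by (subst prod.remove[of _ j]) (auto intro!: prod.cong)
    then show ?thesis by (simp add: lookup_operation split: expr.split)
  qed
  show ?thesis
    by (rule linear_mapI; rule poly_mapping_eqI)
       (auto simp: upd lookup_add algebra_simps split: expr.split)
qed

text \<open>Different linear maps \<open>gs\<close> in the different arguments are allowed, since both homomorphisms (the
  same map everywhere) and derivations (the identity in all arguments but one) are needed.\<close>

lemma operation_linear_extensions:
  assumes len: "length gs = length vs"
  shows "operation n i (map2 linear_extension gs vs) =
    (\<Sum>us\<in>listset (map Poly_Mapping.keys vs).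
      scale (\<Prod>j<length vs. Poly_Mapping.lookup (vs ! j) (us ! j)) (operation n i (map2 (\<lambda>g u. g u) gs us)))"
    (is "_ = (\<Sum>us\<in>?L. scale (?c us) (?op us))")
proof (rule poly_mapping_eqI)
  fix x
  have lenL: "length us = length vs" if "us \<in> ?L" for us using that by (simp add: in_listset_iff)
  show "Poly_Mapping.lookup (operation n i (map2 linear_extension gs vs)) x =
      Poly_Mapping.lookup (\<Sum>us\<in>?L. scale (?c us) (?op us)) x"
  proof (cases x)
    case (Op n' i' ws)
    show ?thesis
    proof (cases "n' = n \<and> i' = i \<and> length ws = length vs")
      case True
      have "Poly_Mapping.lookup (operation n i (map2 linear_extension gs vs)) x =
          (\<Prod>j<length vs. \<Sum>u\<in>Poly_Mapping.keys (vs ! j).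
             Poly_Mapping.lookup (vs ! j) u * Poly_Mapping.lookup ((gs ! j) u) (ws ! j))"
        using Op True len by (simp add: lookup_operation linear_extension_def lookup_sum)
      also have "\<dots> = (\<Prod>j<length (map Poly_Mapping.keys vs). \<Sum>u\<in>map Poly_Mapping.keys vs ! j.
             Poly_Mapping.lookup (vs ! j) u * Poly_Mapping.lookup ((gs ! j) u) (ws ! j))"
        by simp
      also have "\<dots> = (\<Sum>us\<in>?L. \<Prod>j<length vs.
             Poly_Mapping.lookup (vs ! j) (us ! j) * Poly_Mapping.lookup ((gs ! j) (us ! j)) (ws ! j))"
        by (subst sum_listset_prod[symmetric]) simp
      also have "\<dots> = (\<Sum>us\<in>?L. ?c us * Poly_Mapping.lookup (?op us) x)"
        using Op True len lenL by (intro sum.cong) (auto simp: lookup_operation prod.distrib)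
      finally show ?thesis by (simp add: lookup_sum)
    next
      case False
      then have "Poly_Mapping.lookup (?op us) x = 0" if "us \<in> ?L" for us
        using Op len lenL[OF that] by (auto simp: lookup_operation)
      then show ?thesis using False Op len by (auto simp: lookup_operation lookup_sum)
    qed
  qed (simp add: lookup_operation lookup_sum)
qed

lemma linear_extension_operation:
  "linear_extension g (operation n i vs) = (\<Sum>us\<in>listset (map Poly_Mapping.keys vs).
      scale (\<Prod>j<length vs. Poly_Mapping.lookup (vs ! j) (us ! j)) (g (Op n i us)))"
proof -
  have "operation n i vs = (\<Sum>us\<in>listset (map Poly_Mapping.keys vs).
      scale (\<Prod>j<length vs. Poly_Mapping.lookup (vs ! j) (us ! j)) (unit_vec (Op n i us)))"
    unfolding operation_def
    by (intro sum.cong refl, subst single_eq_scale)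
       (simp add: in_listset_iff prod.list_conv_set_nth atLeast0LessThan)
  then show ?thesis
    by (simp only: linear_map_sum[OF linear_linear_extension] linear_extension_unit)
qed

section \<open>Homomorphisms of the free algebra\<close>

fun substitute :: "(nat \<Rightarrow> (expr \<Rightarrow>\<^sub>0 'k::field)) \<Rightarrow> expr \<Rightarrow> (expr \<Rightarrow>\<^sub>0 'k)" where
  "substitute M (Gen j) = M j"
| "substitute M (Op n i us) = operation n i (map (substitute M) us)"

definition free_hom :: "(nat \<Rightarrow> (expr \<Rightarrow>\<^sub>0 'k::field)) \<Rightarrow> (expr \<Rightarrow>\<^sub>0 'k) \<Rightarrow> (expr \<Rightarrow>\<^sub>0 'k)" where
  "free_hom M = linear_extension (substitute M)"

lemma linear_free_hom: "linear_map (free_hom M)"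
  unfolding free_hom_def by (rule linear_linear_extension)

lemma free_hom_gen [simp]: "free_hom M (gen j) = M j"
  by (simp add: free_hom_def gen_def)

lemma free_hom_operation: "free_hom M (operation n i vs) = operation n i (map (free_hom M) vs)"
proof -
  let ?gs = "map (\<lambda>_. substitute M) vs"
  have "map (free_hom M) vs = map2 linear_extension ?gs vs"
    by (intro nth_equalityI) (auto simp: free_hom_def)
  moreover have "map2 (\<lambda>g u. g u) ?gs us = map (substitute M) us"
    if "us \<in> listset (map Poly_Mapping.keys vs)" for us
    using that by (intro nth_equalityI) (auto simp: in_listset_iff)
  ultimately show ?thesis
    by (simp add: operation_linear_extensions free_hom_def linear_extension_operation)
qed

text \<open>Both sides are homomorphisms, so they agree as soon as they agree on the generators.\<close>

lemma free_hom_inverse: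
  fixes v :: "expr \<Rightarrow>\<^sub>0 'k::field"
  assumes "\<And>j. free_hom M (M' j) = gen j"
  shows "free_hom M (free_hom M' v) = v"
proof -
  have units: "free_hom M (free_hom M' (unit_vec u)) = unit_vec u" for u
  proof (induction u)
    case (Gen j)
    then show ?case using assms[of j] by (simp add: free_hom_def gen_def)
  next
    case (Op n i us)
    then show ?case
      by (simp add: operation_units[symmetric] free_hom_operation o_def cong: map_cong)
  qed
  interpret h: Vector_Spaces.linear scale scale "free_hom A" for A :: "nat \<Rightarrow> expr \<Rightarrow>\<^sub>0 'k" by (rule linear_free_hom)
  define F where "F = free_hom M \<circ> free_hom M'"
  have "linear_map F" "linear_map (id :: (expr \<Rightarrow>\<^sub>0 'k) \<Rightarrow> _)"
    by (rule linear_mapI; simp add: F_def h.add h.scale)+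
  moreover have "F (unit_vec u) = id (unit_vec u)" for u using units by (simp add: F_def)
  ultimately have "F v = id v" by (rule linear_map_eqI)
  then show ?thesis by (simp add: F_def)
qed

section \<open>Derivations of the free algebra\<close>

text \<open>Unlike \<^const>\<open>derivation\<close>, this asks for the product rule for all operation symbols and all
  vectors, whether or not they belong to the given signature. The auxiliary derivations satisfy it,
  and identities between them then hold without side conditions.\<close>

definition leibniz :: "((expr \<Rightarrow>\<^sub>0 'k::field) \<Rightarrow> (expr \<Rightarrow>\<^sub>0 'k)) \<Rightarrow> bool" where
  "leibniz D \<longleftrightarrow> linear_map D \<and>
     (\<forall>n i vs. D (operation n i vs) = (\<Sum>j<length vs. operation n i (vs[j := D (vs ! j)])))"

lemma leibniz_eqI:
  assumes "leibniz D" "leibniz D'" "\<And>j. D (gen j) = D' (gen j)"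
  shows "D v = D' v"
proof (rule linear_map_eqI[where f = D and g = D'])
  show "linear_map D" "linear_map D'" using assms unfolding leibniz_def by auto
  fix u
  show "D (unit_vec u) = D' (unit_vec u)"
  proof (induction u)
    case (Gen j)
    then show ?case using assms(3)[of j] by (simp add: gen_def)
  next
    case (Op n i us)
    then show ?case
      using assms(1,2) unfolding operation_units[symmetric] leibniz_def by (auto intro!: sum.cong)
  qed
qed

text \<open>In the double sums for \<open>D D'\<close> and \<open>D' D\<close> the terms in which the two operators hit different
  arguments cancel.\<close>

lemma leibniz_commutator:
  assumes D: "leibniz D" and D': "leibniz D'"
  shows "leibniz (\<lambda>v. D (D' v) - D' (D v))"
proof -
  interpret D: Vector_Spaces.linear scale scale D using D unfolding leibniz_def by simp
  interpret D': Vector_Spaces.linear scale scale D' using D' unfolding leibniz_def by simp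
  \<comment> \<open>The diagonal terms are kept apart, because there the second operator meets the updated argument.\<close>
  have twice: "A (A' (operation n i vs)) = (\<Sum>j<length vs. \<Sum>k<length vs.
      if k = j then operation n i (vs[j := A (A' (vs ! j))])
      else operation n i (vs[j := A' (vs ! j), k := A (vs ! k)]))"
    if "leibniz A" "leibniz A'" for A A' :: "(expr \<Rightarrow>\<^sub>0 'a) \<Rightarrow> (expr \<Rightarrow>\<^sub>0 'a)" and n i vs
  proof -
    interpret A: Vector_Spaces.linear scale scale A using that unfolding leibniz_def by simp
    have "A (A' (operation n i vs)) = (\<Sum>j<length vs. A (operation n i (vs[j := A' (vs ! j)])))"
      using that(2) unfolding leibniz_def by (simp add: A.sum)
    also have "\<dots> = (\<Sum>j<length vs. \<Sum>k<length vs.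
        operation n i (vs[j := A' (vs ! j), k := A (vs[j := A' (vs ! j)] ! k)]))"
      using that(1) unfolding leibniz_def by simp
    finally show ?thesis by (auto intro!: sum.cong simp: nth_list_update)
  qed
  have "D (D' (operation n i vs)) - D' (D (operation n i vs)) =
      (\<Sum>j<length vs. operation n i (vs[j := D (D' (vs ! j)) - D' (D (vs ! j))]))" for n i vs
  proof -
    let ?N = "{..<length vs}"
    let ?T = "\<lambda>j k. if k = j then operation n i (vs[j := D (D' (vs ! j))])
      else operation n i (vs[j := D' (vs ! j), k := D (vs ! k)])"
    let ?T' = "\<lambda>j k. if k = j then operation n i (vs[j := D' (D (vs ! j))])
      else operation n i (vs[j := D (vs ! j), k := D' (vs ! k)])"
    have "D (D' (operation n i vs)) - D' (D (operation n i vs)) =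
        (\<Sum>j\<in>?N. \<Sum>k\<in>?N. ?T j k) - (\<Sum>j\<in>?N. \<Sum>k\<in>?N. ?T' j k)"
      by (simp only: twice[OF D D'] twice[OF D' D])
    also have "(\<Sum>j\<in>?N. \<Sum>k\<in>?N. ?T' j k) = (\<Sum>j\<in>?N. \<Sum>k\<in>?N. ?T' k j)"
      by (rule sum.swap)
    also have "(\<Sum>j\<in>?N. \<Sum>k\<in>?N. ?T j k) - (\<Sum>j\<in>?N. \<Sum>k\<in>?N. ?T' k j) =
        (\<Sum>j\<in>?N. \<Sum>k\<in>?N. ?T j k - ?T' k j)"
      by (simp only: sum_subtractf)
    also have "\<dots> = (\<Sum>j\<in>?N. \<Sum>k\<in>?N. if k = j then
        operation n i (vs[j := D (D' (vs ! j)) - D' (D (vs ! j))]) else 0)"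
    proof (intro sum.cong refl)
      fix j k assume "j \<in> ?N" "k \<in> ?N"
      then interpret o: Vector_Spaces.linear scale scale "\<lambda>v. operation n i (vs[j := v])"
        using linear_operation by simp
      show "?T j k - ?T' k j = (if k = j then
        operation n i (vs[j := D (D' (vs ! j)) - D' (D (vs ! j))]) else 0)"
        by (auto simp: o.diff list_update_swap)
    qed
    finally show ?thesis by (simp add: sum.delta)
  qed
  moreover have "linear_map (\<lambda>v. D (D' v) - D' (D v))"
    by (rule linear_mapI)
       (simp_all add: D.add D'.add D.scale D'.scale kspace.scale_right_diff_distrib)
  ultimately show ?thesis unfolding leibniz_def by blast
qed

text \<open>The derivation with prescribed values \<open>a j\<close> on the generators. Writing \<open>map (derive_expr a) us ! j\<close>
  instead of \<open>derive_expr a (us ! j)\<close> makes the recursion visibly structural.\<close>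

fun derive_expr :: "(nat \<Rightarrow> (expr \<Rightarrow>\<^sub>0 'k::field)) \<Rightarrow> expr \<Rightarrow> (expr \<Rightarrow>\<^sub>0 'k)" where
  "derive_expr a (Gen j) = a j"
| "derive_expr a (Op n i us) =
     (\<Sum>j<length us. operation n i ((map unit_vec us)[j := map (derive_expr a) us ! j]))"

definition free_derivation :: "(nat \<Rightarrow> (expr \<Rightarrow>\<^sub>0 'k::field)) \<Rightarrow> (expr \<Rightarrow>\<^sub>0 'k) \<Rightarrow> (expr \<Rightarrow>\<^sub>0 'k)" where
  "free_derivation a = linear_extension (derive_expr a)"

lemma free_derivation_gen [simp]: "free_derivation a (gen j) = a j"
  by (simp add: free_derivation_def gen_def)

lemma linear_free_derivation: "linear_map (free_derivation a)"
  unfolding free_derivation_def by (rule linear_linear_extension)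

lemma leibniz_free_derivation: "leibniz (free_derivation a)"
  unfolding leibniz_def
proof (intro conjI allI linear_free_derivation)
  fix n i and vs :: "(expr \<Rightarrow>\<^sub>0 'a) list"
  let ?L = "listset (map Poly_Mapping.keys vs)"
  let ?c = "\<lambda>us. \<Prod>j<length vs. Poly_Mapping.lookup (vs ! j) (us ! j)"
  let ?gs = "\<lambda>j. (replicate (length vs) unit_vec)[j := derive_expr a]"
  have len: "length us = length vs" if "us \<in> ?L" for us using that by (simp add: in_listset_iff)
  have "free_derivation a (operation n i vs) = (\<Sum>us\<in>?L. scale (?c us) (\<Sum>j<length vs.
      operation n i ((map unit_vec us)[j := derive_expr a (us ! j)])))"
    unfolding free_derivation_def linear_extension_operation
    by (intro sum.cong refl) (auto simp: len intro!: arg_cong[of _ _ "scale _"] sum.cong)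
  also have "\<dots> = (\<Sum>j<length vs. \<Sum>us\<in>?L. scale (?c us)
      (operation n i ((map unit_vec us)[j := derive_expr a (us ! j)])))"
    by (simp add: kspace.scale_sum_right sum.swap[of _ ?L])
  also have "\<dots> = (\<Sum>j<length vs. operation n i (vs[j := free_derivation a (vs ! j)]))"
  proof (intro sum.cong refl)
    fix j assume j: "j \<in> {..<length vs}"
    then have 1: "vs[j := free_derivation a (vs ! j)] = map2 linear_extension (?gs j) vs"
      by (intro nth_equalityI) (auto simp: nth_list_update free_derivation_def)
    have 2: "(map unit_vec us)[j := derive_expr a (us ! j)] = map2 (\<lambda>g u. g u) (?gs j) us"
      if "us \<in> ?L" for us
      using len[OF that] j by (intro nth_equalityI) (auto simp: nth_list_update)
    show "(\<Sum>us\<in>?L. scale (?c us) (operation n i ((map unit_vec us)[j := derive_expr a (us ! j)]))) =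
        operation n i (vs[j := free_derivation a (vs ! j)])"
      unfolding 1 by (subst operation_linear_extensions) (auto simp: 2)
  qed
  finally show "free_derivation a (operation n i vs) =
      (\<Sum>j<length vs. operation n i (vs[j := free_derivation a (vs ! j)]))" .
qed

section \<open>Weights of expressions\<close>

fun weight :: "(nat \<Rightarrow> int) \<Rightarrow> expr \<Rightarrow> int" where
  "weight g (Gen j) = g j"
| "weight g (Op n i us) = sum_list (map (weight g) us)"

text \<open>A derivation that is diagonal on the generators is diagonal on all expressions, and its
  eigenvalues add up over the leaves.\<close>

lemma free_derivation_weight:
  fixes g :: "nat \<Rightarrow> int"
  shows "free_derivation (\<lambda>j. scale (of_int (g j)) (gen j)) (unit_vec u) =
    (scale (of_int (weight g u)) (unit_vec u) :: expr \<Rightarrow>\<^sub>0 'k::field)"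
proof (induction u)
  case (Gen j)
  then show ?case by (simp add: free_derivation_def gen_def)
next
  case (Op n i us)
  let ?h = "free_derivation (\<lambda>j. scale (of_int (g j)) (gen j)) :: (expr \<Rightarrow>\<^sub>0 'k) \<Rightarrow> _"
  have "?h (unit_vec (Op n i us)) = (\<Sum>j<length us. operation n i ((map unit_vec us)[j := ?h (unit_vec (us ! j))]))"
    using leibniz_free_derivation[of "\<lambda>j. scale (of_int (g j)) (gen j) :: expr \<Rightarrow>\<^sub>0 'k"]
    unfolding operation_units[symmetric] leibniz_def by (auto intro!: sum.cong)
  also have "\<dots> = (\<Sum>j<length us. scale (of_int (weight g (us ! j))) (unit_vec (Op n i us)))"
  proof (intro sum.cong refl)
    fix j assume j: "j \<in> {..<length us}"
    then interpret o: Vector_Spaces.linear scale scale "\<lambda>v. operation n i ((map unit_vec us)[j := v])"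
      using linear_operation[of j "map unit_vec us"] by simp
    have "(map unit_vec us)[j := unit_vec (us ! j) :: expr \<Rightarrow>\<^sub>0 'k] = map unit_vec us"
      using j by (metis list_update_id map_update)
    then show "operation n i ((map unit_vec us)[j := ?h (unit_vec (us ! j))]) =
        scale (of_int (weight g (us ! j))) (unit_vec (Op n i us))"
      using Op[of "us ! j"] j by (simp add: o.scale operation_units)
  qed
  also have "\<dots> = scale (of_int (weight g (Op n i us))) (unit_vec (Op n i us))"
    by (simp add: kspace.scale_sum_left[symmetric] sum_list_sum_nth atLeast0LessThan)
  finally show ?case .
qed

lemma keys_operation_update:
  assumes "j < length us"
  shows "Poly_Mapping.keys (operation n i ((map unit_vec us)[j := v]))
    \<subseteq> (\<lambda>x. Op n i (us[j := x])) ` Poly_Mapping.keys (v :: expr \<Rightarrow>\<^sub>0 'k::field)"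
proof
  interpret o: Vector_Spaces.linear scale scale
    "\<lambda>v :: expr \<Rightarrow>\<^sub>0 'k. operation n i ((map unit_vec us)[j := v])"
    using linear_operation[of j "map unit_vec us"] assms by simp
  let ?S = "supported ((\<lambda>x. Op n i (us[j := x])) ` Poly_Mapping.keys v) :: (expr \<Rightarrow>\<^sub>0 'k) set"
  have upd: "(map unit_vec us)[j := unit_vec x :: expr \<Rightarrow>\<^sub>0 'k] = map unit_vec (us[j := x])" for x
    by (simp add: map_update)
  have "operation n i ((map unit_vec us)[j := v]) \<in> ?S"
    by (rule linear_map_supportedI[OF o.linear_axioms subspace_supported, where C = "Poly_Mapping.keys v"])
       (auto simp: upd operation_units)
  then show "x \<in> Poly_Mapping.keys (operation n i ((map unit_vec us)[j := v])) \<Longrightarrow>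
      x \<in> (\<lambda>x. Op n i (us[j := x])) ` Poly_Mapping.keys v" for x by blast
qed

lemma sum_list_map_update:
  assumes "j < length us" "h x = h (us ! j) + c"
  shows "sum_list (map h (us[j := x])) = sum_list (map h us) + (c :: 'a::comm_monoid_add)"
  using assms
proof (induction us arbitrary: j)
  case (Cons u us)
  then show ?case by (cases j) (auto simp: add_ac)
qed simp

text \<open>A derivation replaces one leaf at a time, so a shift of the weight by \<open>c\<close> on the generators is a
  shift by \<open>c\<close> everywhere.\<close>

lemma free_derivation_graded:
  assumes a: "\<And>j. j \<in> {1..d} \<Longrightarrow> a j \<in> supported {Gen j' |j'. j' \<in> {1..d} \<and> g j' = g j + c}"
    and u: "u \<in> magma p d"
  shows "free_derivation a (unit_vec u)
    \<in> supported {x \<in> magma p d. deg x = deg u \<and> weight g x = weight g u + c}"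
  using u
proof (induction u rule: magma.induct)
  case (gen j)
  then show ?case using a[of j] by (fastforce simp: free_derivation_def intro: magma.gen)
next
  case (op n i us)
  have eq: "free_derivation a (unit_vec (Op n i us)) =
      (\<Sum>j<length us. operation n i ((map unit_vec us)[j := free_derivation a (unit_vec (us ! j))]))"
    by (auto simp: free_derivation_def intro!: sum.cong)
  show ?case unfolding eq
  proof (intro kspace.subspace_sum[OF subspace_supported], safe)
    fix j x assume j: "j < length us"
      and "x \<in> Poly_Mapping.keys (operation n i ((map unit_vec us)[j := free_derivation a (unit_vec (us ! j))]))"
    then obtain y where y: "y \<in> Poly_Mapping.keys (free_derivation a (unit_vec (us ! j)))"
      and x: "x = Op n i (us[j := y])" using keys_operation_update by blast
    then have y: "y \<in> magma p d" "deg y = deg (us ! j)" "weight g y = weight g (us ! j) + c"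
      using op(3) j by (auto simp: subset_iff)
    show "x \<in> magma p d"
      unfolding x using op y(1) set_update_subset_insert[of us j y] by (intro magma.op) auto
    show "deg x = deg (Op n i us)"
      using sum_list_map_update[OF j, of deg y 0] y(2) by (simp add: x)
    show "weight g x = weight g (Op n i us) + c"
      using sum_list_map_update[OF j, of "weight g" y c] y(3) by (simp add: x)
  qed
qed

lemma free_hom_graded:
  assumes M: "\<And>j. j \<in> {1..d} \<Longrightarrow> M j \<in> supported (Gen ` {1..d})"
    and u: "u \<in> magma p d"
  shows "free_hom M (unit_vec u) \<in> supported {x \<in> magma p d. deg x = deg u}"
  using u
proof (induction u rule: magma.induct)
  case (gen j)
  then show ?case using M[of j] by (fastforce simp: free_hom_def intro: magma.gen)
next
  case (op n i us)
  show ?case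
  proof (safe)
    fix x assume "x \<in> Poly_Mapping.keys (free_hom M (unit_vec (Op n i us)))"
    then have "Poly_Mapping.lookup (operation n i (map (\<lambda>u. free_hom M (unit_vec u)) us)) x \<noteq> 0"
      by (simp add: free_hom_def in_keys_iff)
    then obtain ws where x: "x = Op n i ws" and len: "length ws = length us"
      and "\<forall>j<length us. ws ! j \<in> Poly_Mapping.keys (free_hom M (unit_vec (us ! j)))"
      by (auto simp: lookup_operation in_keys_iff split: expr.splits if_splits)
    then have ws: "ws ! j \<in> {x \<in> magma p d. deg x = deg (us ! j)}" if "j < length us" for j
      using op(3) that nth_mem[OF that] by blast
    show "x \<in> magma p d"
      unfolding x using op ws len by (intro magma.op) (auto simp: in_set_conv_nth)
    have "map deg ws = map deg us" using ws len by (intro nth_equalityI) auto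
    then show "deg x = deg (Op n i us)" by (simp add: x)
  qed
qed

section \<open>Counting expressions by weight\<close>

lemma magma_Op_iff:
  "Op n i us \<in> magma p d \<longleftrightarrow> (n, i) \<in> symbols p \<and> length us = n \<and> (\<forall>u\<in>set us. u \<in> magma p d)"
  by (auto intro: magma.op elim: magma.cases)

lemma magma_Gen_iff: "Gen j \<in> magma p d \<longleftrightarrow> j \<in> {1..d}"
  by (auto intro: magma.gen elim: magma.cases)

lemma length_le_sum_list:
  assumes "\<forall>y\<in>set xs. (1::nat) \<le> y"
  shows "length xs \<le> sum_list xs"
  using assms by (induction xs) auto

lemma member_plus_length_le_sum_list:
  assumes "x \<in> set xs" "\<forall>y\<in>set xs. (1::nat) \<le> y"
  shows "x + length xs \<le> sum_list xs + 1"
  using assms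
proof (induction xs)
  case (Cons y ys)
  then show ?case using length_le_sum_list[of ys] by auto
qed simp

lemma deg_pos: "u \<in> magma p d \<Longrightarrow> 1 \<le> deg u"
proof (induction u rule: magma.induct)
  case (op n i us)
  then have "length us \<le> sum_list (map deg us)" using length_le_sum_list[of "map deg us"] by auto
  then show ?case using op by (auto simp: symbols_def)
qed simp

text \<open>As every symbol has at least two arguments and every argument has positive degree, the
  arguments have smaller degree than the expression, and their number is at most that degree. Only
  finitely many symbols can then occur.\<close>

lemma finite_degree_le: "finite {u \<in> magma p d. deg u \<le> m}"
proof (induction m)
  case 0
  have "{u \<in> magma p d. deg u \<le> 0} = {}" using deg_pos by fastforce
  then show ?case by (metis finite.emptyI)
next
  case (Suc m)
  let ?S = "{u \<in> magma p d. deg u \<le> m}"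
  let ?T = "Gen ` {1..d} \<union> (\<Union>n\<in>{..Suc m}. \<Union>i\<in>{..p n}. Op n i ` {us. set us \<subseteq> ?S \<and> length us = n})"
  have "{u \<in> magma p d. deg u \<le> Suc m} \<subseteq> ?T"
  proof
    fix u assume u: "u \<in> {u \<in> magma p d. deg u \<le> Suc m}"
    show "u \<in> ?T"
    proof (cases u)
      case (Gen j)
      then show ?thesis using u by (auto simp: magma_Gen_iff)
    next
      case (Op n i us)
      then have us: "(n, i) \<in> symbols p" "length us = n" "\<forall>u\<in>set us. u \<in> magma p d"
        and deg: "sum_list (map deg us) \<le> Suc m" using u by (auto simp: magma_Op_iff)
      have pos: "\<forall>y\<in>set (map deg us). 1 \<le> y" using us(3) deg_pos by auto
      have "n \<le> Suc m" using length_le_sum_list[OF pos] us(2) deg by simp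
      moreover have "i \<le> p n" using us(1) by (auto simp: symbols_def)
      moreover have "deg v \<le> m" if "v \<in> set us" for v
        using member_plus_length_le_sum_list[OF _ pos, of "deg v"] that us(1,2) deg
        by (auto simp: symbols_def)
      ultimately have "n \<in> {..Suc m}" "i \<in> {..p n}" "us \<in> {us. set us \<subseteq> ?S \<and> length us = n}"
        using us by auto
      then show ?thesis unfolding Op by blast
    qed
  qed
  moreover have "finite ?T" using Suc by (auto intro!: finite_lists_length_eq)
  ultimately show ?case by (rule finite_subset)
qed

lemma finite_degree_eq: "finite {u \<in> magma p d. deg u = m}"
  by (rule finite_subset[OF _ finite_degree_le[of p d m]]) auto

text \<open>The shape of an expression is its image in the free magma on one generator.\<close>

fun shape :: "expr \<Rightarrow> expr" where
  "shape (Gen j) = Gen 1"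
| "shape (Op n i us) = Op n i (map shape us)"

lemma shape_magma: "u \<in> magma p d \<Longrightarrow> shape u \<in> magma p 1"
  by (induction u rule: magma.induct) (auto simp: magma_Op_iff magma_Gen_iff)

lemma deg_shape: "deg (shape u) = deg u"
  by (induction u) (auto simp: o_def intro!: arg_cong[of _ _ sum_list])

text \<open>An expression of shape \<open>t\<close> is an independent choice of one generator for each of the \<open>deg t\<close>
  leaves; \<open>\<phi>\<close> turns the sum of the weights of the leaves into a product.\<close>

lemma sum_over_shape:
  fixes \<phi> :: "int \<Rightarrow> 'r::comm_ring_1"
  assumes \<phi>: "\<phi> 0 = 1" "\<And>x y. \<phi> (x + y) = \<phi> x * \<phi> y"
    and t: "t \<in> magma p 1"
  shows "(\<Sum>u | u \<in> magma p d \<and> shape u = t. \<phi> (weight g u)) = (\<Sum>j=1..d. \<phi> (g j)) ^ deg t"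
  using t
proof (induction t rule: magma.induct)
  case (gen j)
  then have "j = 1" by simp
  have "u \<in> magma p d \<and> shape u = Gen 1 \<longleftrightarrow> u \<in> Gen ` {1..d}" for u
    by (cases u) (auto simp: magma_Gen_iff)
  then have "{u. u \<in> magma p d \<and> shape u = Gen j} = Gen ` {1..d}" using \<open>j = 1\<close> by auto
  then show ?case by (simp add: sum.reindex inj_on_def)
next
  case (op n i ts)
  let ?F = "\<lambda>t. {u. u \<in> magma p d \<and> shape u = t}"
  have "u \<in> ?F (Op n i ts) \<longleftrightarrow> u \<in> Op n i ` listset (map ?F ts)" for u
  proof (cases u)
    case (Op n' i' us)
    have "u \<in> Op n i ` listset (map ?F ts) \<longleftrightarrow> n' = n \<and> i' = i \<and> us \<in> listset (map ?F ts)"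
      using Op by auto
    also have "us \<in> listset (map ?F ts) \<longleftrightarrow> (\<forall>u\<in>set us. u \<in> magma p d) \<and> map shape us = ts"
      by (auto simp: in_listset_iff all_set_conv_all_nth list_eq_iff_nth_eq)
    also have "n' = n \<and> i' = i \<and> (\<forall>u\<in>set us. u \<in> magma p d) \<and> map shape us = ts \<longleftrightarrow>
        u \<in> ?F (Op n i ts)"
      using Op op(1,2) by (auto simp: magma_Op_iff)
    finally show ?thesis by simp
  qed auto
  then have fibre: "?F (Op n i ts) = Op n i ` listset (map ?F ts)" by blast
  have multiplicative: "\<phi> (sum_list (map (weight g) us)) = (\<Prod>j<length us. \<phi> (weight g (us ! j)))" for us
    by (induction us) (auto simp: \<phi> prod.lessThan_Suc_shift simp del: prod.lessThan_Suc)
  have "(\<Sum>u\<in>?F (Op n i ts). \<phi> (weight g u)) =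
      (\<Sum>us\<in>listset (map ?F ts). \<Prod>j<length (map ?F ts). \<phi> (weight g (us ! j)))"
    unfolding fibre by (subst sum.reindex) (auto simp: inj_on_def multiplicative in_listset_iff intro!: sum.cong)
  also have "\<dots> = (\<Prod>j<length (map ?F ts). \<Sum>u\<in>map ?F ts ! j. \<phi> (weight g u))"
    by (rule sum_listset_prod)
  also have "\<dots> = (\<Prod>j<length ts. (\<Sum>j=1..d. \<phi> (g j)) ^ deg (ts ! j))"
    using op(3) by (intro prod.cong) auto
  also have "\<dots> = (\<Sum>j=1..d. \<phi> (g j)) ^ deg (Op n i ts)"
    by (simp add: power_sum[symmetric] sum_list_sum_nth atLeast0LessThan)
  finally show ?case .
qed

lemma weight_generating_function:
  fixes \<phi> :: "int \<Rightarrow> 'r::comm_ring_1"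
  assumes \<phi>: "\<phi> 0 = 1" "\<And>x y. \<phi> (x + y) = \<phi> x * \<phi> y"
  shows "(\<Sum>u | u \<in> magma p d \<and> deg u = m. \<phi> (weight g u)) =
    of_nat (card {t \<in> magma p 1. deg t = m}) * (\<Sum>j=1..d. \<phi> (g j)) ^ m"
proof -
  let ?B = "{u \<in> magma p d. deg u = m}" and ?T = "{t \<in> magma p 1. deg t = m}"
  have "(\<Sum>u\<in>?B. \<phi> (weight g u)) = (\<Sum>t\<in>?T. \<Sum>u | u \<in> ?B \<and> shape u = t. \<phi> (weight g u))"
    by (rule sum.group[symmetric]) (auto simp: finite_degree_eq deg_shape shape_magma simp del: One_nat_def)
  also have "\<dots> = (\<Sum>t\<in>?T. (\<Sum>j=1..d. \<phi> (g j)) ^ m)"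
  proof (rule sum.cong)
    fix t assume t: "t \<in> ?T"
    then have "{u. u \<in> ?B \<and> shape u = t} = {u. u \<in> magma p d \<and> shape u = t}"
      by (auto simp: deg_shape)
    then show "(\<Sum>u | u \<in> ?B \<and> shape u = t. \<phi> (weight g u)) = (\<Sum>j=1..d. \<phi> (g j)) ^ m"
      using sum_over_shape[where \<phi> = \<phi> and t = t and p = p and d = d and g = g, OF \<phi>] t by auto
  qed simp
  finally show ?thesis by simp
qed

section \<open>Positions inside Jordan cells\<close>

text \<open>For cells of sizes \<open>ss\<close> put one after the other, \<open>cell_pos ss b\<close> is the position, counted from 0,
  of the index \<open>b\<close> inside its cell, and \<open>cell_top ss b\<close> is the last position of that cell. Beyond
  the last cell both are 0.\<close>

fun cell_pos :: "nat list \<Rightarrow> nat \<Rightarrow> nat" where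
  "cell_pos [] b = 0"
| "cell_pos (s # ss) b = (if b < s then b else cell_pos ss (b - s))"

fun cell_top :: "nat list \<Rightarrow> nat \<Rightarrow> nat" where
  "cell_top [] b = 0"
| "cell_top (s # ss) b = (if b < s then s - 1 else cell_top ss (b - s))"

fun cell_eigenvalue :: "(nat \<times> 'a::zero) list \<Rightarrow> nat \<Rightarrow> 'a" where
  "cell_eigenvalue [] b = 0"
| "cell_eigenvalue ((s, x) # cs) b = (if b < s then x else cell_eigenvalue cs (b - s))"

lemma cell_pos_le_top: "cell_pos ss b \<le> cell_top ss b"
  by (induction ss arbitrary: b) auto

lemma cell_pos_0: "0 \<notin> set ss \<Longrightarrow> cell_pos ss 0 = 0"
  by (cases ss) auto

lemma cell_next:
  assumes "cell_pos ss b < cell_top ss b"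
  shows "Suc b < sum_list ss" "cell_pos ss (Suc b) = Suc (cell_pos ss b)" "cell_top ss (Suc b) = cell_top ss b"
  using assms
proof (induction ss arbitrary: b)
  case (Cons s ss)
  { case 1 then show ?case using Cons(1)[of "b - s"] by (auto split: if_splits) }
  { case 2 then show ?case using Cons(2)[of "b - s"] by (auto split: if_splits simp: Suc_diff_le) }
  { case 3 then show ?case using Cons(3)[of "b - s"] by (auto split: if_splits simp: Suc_diff_le) }
qed simp_all

lemma cell_previous:
  assumes "0 \<notin> set ss" "cell_pos ss b > 0"
  shows "b > 0" "cell_pos ss b = Suc (cell_pos ss (b - 1))" "cell_top ss (b - 1) = cell_top ss b"
proof -
  have "b > 0 \<and> cell_pos ss b = Suc (cell_pos ss (b - 1)) \<and> cell_top ss (b - 1) = cell_top ss b"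
    using assms
  proof (induction ss arbitrary: b)
    case (Cons s ss)
    show ?case
    proof (cases "b < s")
      case False
      then have "b - s > 0" "cell_pos ss (b - s) = Suc (cell_pos ss (b - s - 1))"
        "cell_top ss (b - s - 1) = cell_top ss (b - s)"
        using Cons.IH[of "b - s"] Cons.prems by auto
      moreover then have "b - 1 - s = b - s - 1" "\<not> b - 1 < s" by auto
      ultimately show ?thesis using False by simp
    qed (use Cons.prems in auto)
  qed simp
  then show "b > 0" "cell_pos ss b = Suc (cell_pos ss (b - 1))" "cell_top ss (b - 1) = cell_top ss b"
    by auto
qed

lemma cell_eigenvalue_previous:
  assumes "0 \<notin> set (map fst cs)" "cell_pos (map fst cs) b > 0"
  shows "cell_eigenvalue cs (b - 1) = cell_eigenvalue cs b"
  using assms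
proof (induction cs arbitrary: b)
  case (Cons c cs)
  obtain s x where c: "c = (s, x)" by force
  show ?case
  proof (cases "b < s")
    case False
    then have pos: "cell_pos (map fst cs) (b - s) > 0" "0 \<notin> set (map fst cs)"
      using Cons.prems c by auto
    then have "b - s > 0" using cell_previous(1) by blast
    then have "b - 1 - s = b - s - 1" "\<not> b - 1 < s" by auto
    then show ?thesis using Cons.IH[of "b - s"] pos False c by simp
  qed (use c in auto)
qed simp

lemma sum_over_cells:
  fixes F :: "nat \<Rightarrow> nat \<Rightarrow> 'r::comm_monoid_add"
  shows "(\<Sum>b<sum_list ss. F (cell_top ss b) (cell_pos ss b)) = (\<Sum>s\<leftarrow>ss. \<Sum>j<s. F (s - 1) j)"
proof (induction ss)
  case (Cons s ss)
  have "(\<Sum>b<sum_list (s # ss). F (cell_top (s # ss) b) (cell_pos (s # ss) b)) =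
      (\<Sum>b<s. F (cell_top (s # ss) b) (cell_pos (s # ss) b)) +
      (\<Sum>b<sum_list ss. F (cell_top (s # ss) (b + s)) (cell_pos (s # ss) (b + s)))"
    using sum.atLeastLessThan_concat[of 0 s "s + sum_list ss" "\<lambda>b. F (cell_top (s # ss) b) (cell_pos (s # ss) b)"]
      sum.shift_bounds_nat_ivl[of "\<lambda>b. F (cell_top (s # ss) b) (cell_pos (s # ss) b)" 0 s "sum_list ss"]
    by (simp add: atLeast0LessThan add.commute)
  then show ?case using Cons by simp
qed simp

lemma jordan_matrix_Cons_index:
  assumes "i < n + sum_list (map fst cs)" "j < n + sum_list (map fst cs)"
  shows "jordan_matrix ((n, x) # cs) $$ (i, j) =
    (if i < n then if j < n then jordan_block n x $$ (i, j) else 0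
     else if j < n then 0 else jordan_matrix cs $$ (i - n, j - n))"
  using assms jordan_matrix_dim[of cs] unfolding jordan_matrix_def
  by (simp add: Let_def)

lemma jordan_matrix_index:
  assumes "0 \<notin> set (map fst cs)" "i < sum_list (map fst cs)" "j < sum_list (map fst cs)"
  shows "jordan_matrix cs $$ (i, j) =
    (if i = j then cell_eigenvalue cs j
     else if Suc i = j \<and> cell_pos (map fst cs) j > 0 then 1 else 0)"
  using assms
proof (induction cs arbitrary: i j)
  case (Cons c cs)
  obtain n x where c: "c = (n, x)" by force
  have bounds: "i < n + sum_list (map fst cs)" "j < n + sum_list (map fst cs)"
    and nz: "0 \<notin> set (map fst cs)" using Cons.prems c by auto
  show ?case
  proof (cases "i < n \<or> j < n")
    case True
    \<comment> \<open>The only entry above the diagonal that joins two cells belongs to a column in position 0.\<close>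
    have "cell_pos (map fst cs) (j - n) = 0" if "Suc i = j" "i < n" "\<not> j < n"
      using that cell_pos_0[OF nz] by (metis diff_is_0_eq less_eq_Suc_le)
    then show ?thesis using True c jordan_matrix_Cons_index[OF bounds] by auto
  next
    case False
    then show ?thesis
      using c Cons.IH[OF nz, of "i - n" "j - n"] bounds jordan_matrix_Cons_index[OF bounds, of x]
      by (auto simp: Suc_diff_le)
  qed
qed simp

section \<open>Passing to a Jordan basis\<close>

lemma gen_eq_unit: "gen j = unit_vec (Gen j)"
  by (simp add: gen_def)

lemma free_algebra_eq_supported: "free_algebra p d = supported (magma p d)"
  by (simp add: free_algebra_def)

lemma KX_eq_supported: "KX d = supported (Gen ` {1..d})"
proof -
  have "gen ` {1..d} = (unit_vec ` Gen ` {1..d} :: (expr \<Rightarrow>\<^sub>0 'a) set)"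
    by (simp add: image_image gen_eq_unit)
  then show ?thesis unfolding KX_def supported_eq_span by simp
qed

lemma linear_operator_on_sum:
  fixes v :: "'i \<Rightarrow> (expr \<Rightarrow>\<^sub>0 'k::field)"
  assumes \<delta>: "linear_operator_on (free_algebra p d) \<delta>" and "finite I" "\<And>i. i \<in> I \<Longrightarrow> v i \<in> free_algebra p d"
  shows "\<delta> (\<Sum>i\<in>I. scale (c i) (v i)) = (\<Sum>i\<in>I. scale (c i) (\<delta> (v i)))"
  using assms(2,3)
proof (induction I)
  case empty
  have "(0 :: expr \<Rightarrow>\<^sub>0 'k) \<in> free_algebra p d" by (simp add: free_algebra_def)
  then have "\<delta> (scale 0 0) = scale 0 (\<delta> 0)" using \<delta> unfolding linear_operator_on_def by blast
  then show ?case by simp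
next
  case (insert i I)
  have "(\<Sum>i\<in>I. scale (c i) (v i)) \<in> free_algebra p d" "scale (c i) (v i) \<in> free_algebra p d"
    using insert.prems unfolding free_algebra_eq_supported
    by (intro kspace.subspace_sum kspace.subspace_scale subspace_supported; simp)+
  then show ?case using insert \<delta> unfolding linear_operator_on_def by simp
qed

text \<open>The generators outside \<open>{1..d}\<close> are left alone, so that invertible matrices give automorphisms
  of the free algebra on all generators at once.\<close>

definition column_vectors :: "nat \<Rightarrow> 'k::field mat \<Rightarrow> nat \<Rightarrow> (expr \<Rightarrow>\<^sub>0 'k)" where
  "column_vectors d P j =
     (if j \<in> {1..d} then \<Sum>i<d. scale (P $$ (i, j - 1)) (gen (Suc i)) else gen j)"

lemma column_vectors_Suc:
  "b < d \<Longrightarrow> column_vectors d P (Suc b) = (\<Sum>i<d. scale (P $$ (i, b)) (gen (Suc i)))"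
  by (simp add: column_vectors_def)

lemma column_vectors_supported:
  "j \<in> {1..d} \<Longrightarrow> column_vectors d P j \<in> supported (Gen ` {1..d})"
  unfolding column_vectors_def
  by (simp only: if_True, intro kspace.subspace_sum kspace.subspace_scale subspace_supported)
     (auto simp: gen_eq_unit)

text \<open>The coordinates of a combination of columns of \<open>P\<close> with the coefficients of a column of \<open>Q\<close> are
  a column of \<open>P * Q\<close>. It serves the inversion of a change of basis and the change of basis of \<open>\<delta>\<close>.\<close>

lemma combine_column_vectors:
  assumes P: "P \<in> carrier_mat d d" and Q: "Q \<in> carrier_mat d d" and b: "b < d"
  shows "(\<Sum>i<d. scale (Q $$ (i, b)) (column_vectors d P (Suc i))) =
    (\<Sum>l<d. scale ((P * Q) $$ (l, b)) (gen (Suc l)))"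
proof -
  have "(\<Sum>i<d. scale (Q $$ (i, b)) (column_vectors d P (Suc i))) =
      (\<Sum>i<d. \<Sum>l<d. scale (P $$ (l, i) * Q $$ (i, b)) (gen (Suc l)))"
    by (intro sum.cong refl) (simp add: column_vectors_Suc kspace.scale_sum_right mult.commute)
  also have "\<dots> = (\<Sum>l<d. scale (\<Sum>i<d. P $$ (l, i) * Q $$ (i, b)) (gen (Suc l)))"
    by (subst sum.swap) (simp add: kspace.scale_sum_left)
  also have "\<dots> = (\<Sum>l<d. scale ((P * Q) $$ (l, b)) (gen (Suc l)))"
    using P Q b by (intro sum.cong refl arg_cong2[where f = scale])
      (simp add: scalar_prod_def atLeast0LessThan)
  finally show ?thesis .
qed

lemma free_hom_column_vectors:
  assumes P: "P \<in> carrier_mat d d" and Q: "Q \<in> carrier_mat d d" and inv: "P * Q = 1\<^sub>m d"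
  shows "free_hom (column_vectors d P) (column_vectors d Q j) = gen j"
proof (cases "j \<in> {1..d}")
  case True
  then obtain b where b: "j = Suc b" "b < d" by (cases j) auto
  have "free_hom (column_vectors d P) (column_vectors d Q j) =
      (\<Sum>i<d. scale (Q $$ (i, b)) (column_vectors d P (Suc i)))"
    using b by (simp add: column_vectors_Suc linear_map_sum[OF linear_free_hom])
  also have "\<dots> = (\<Sum>l<d. scale (1\<^sub>m d $$ (l, b)) (gen (Suc l)))"
    by (simp only: combine_column_vectors[OF P Q b(2)] inv)
  also have "\<dots> = (\<Sum>l<d. if l = b then gen (Suc l) else 0)"
    using b by (intro sum.cong) auto
  finally show ?thesis using b by simp
qed (auto simp: column_vectors_def)

lemma derivation_on_generators:
  assumes \<delta>: "linear_derivation p d \<delta>" and b: "b < d"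
  shows "\<delta> (gen (Suc b)) = (\<Sum>l<d. scale (matrix_on_KX d \<delta> $$ (l, b)) (gen (Suc l)))"
proof -
  let ?v = "\<delta> (gen (Suc b))"
  have "gen (Suc b) \<in> KX d" unfolding KX_def using b by (intro kspace.span_base) auto
  then have "?v \<in> supported (Gen ` {1..d})" using \<delta> unfolding linear_derivation_def KX_eq_supported by blast
  then have "?v = (\<Sum>u\<in>Gen ` {1..d}. scale (Poly_Mapping.lookup ?v u) (unit_vec u))"
    using linear_extension_superset[of "Gen ` {1..d}" ?v unit_vec] by simp
  also have "\<dots> = (\<Sum>j\<in>{1..d}. scale (Poly_Mapping.lookup ?v (Gen j)) (gen j))"
    by (simp add: sum.reindex inj_on_def gen_eq_unit)
  also have "{1..d} = Suc ` {..<d}" by (auto simp: image_iff Suc_le_eq intro: less_imp_Suc_add gr0_implies_Suc)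
     (metis Suc_less_eq Suc_pred less_Suc_eq_le lessThan_iff)
  also have "(\<Sum>j\<in>Suc ` {..<d}. scale (Poly_Mapping.lookup ?v (Gen j)) (gen j)) =
      (\<Sum>l<d. scale (matrix_on_KX d \<delta> $$ (l, b)) (gen (Suc l)))"
    using b by (simp add: sum.reindex matrix_on_KX_def)
  finally show ?thesis .
qed

text \<open>The columns \<open>Y\<close> of the matrix that conjugates \<open>\<delta>\<close> into Jordan form, and those \<open>Y'\<close> of its inverse.
  The first vector of each cell is an eigenvector, and local nilpotency makes its eigenvalue 0; all
  eigenvalues of a cell are equal.\<close>

lemma jordan_basis:
  fixes \<delta> :: "(expr \<Rightarrow>\<^sub>0 'k::field) \<Rightarrow> (expr \<Rightarrow>\<^sub>0 'k)"
  assumes \<delta>: "linear_derivation p d \<delta>" and nilpotent: "locally_nilpotent p d \<delta>"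
    and jnf: "jordan_nf (matrix_on_KX d \<delta>) cs"
  obtains Y Y' :: "nat \<Rightarrow> (expr \<Rightarrow>\<^sub>0 'k)"
  where "sum_list (map fst cs) = d"
    and "\<And>j. free_hom Y (Y' j) = gen j" and "\<And>j. free_hom Y' (Y j) = gen j"
    and "\<And>j. j \<in> {1..d} \<Longrightarrow> Y j \<in> supported (Gen ` {1..d})"
    and "\<And>j. j \<in> {1..d} \<Longrightarrow> Y' j \<in> supported (Gen ` {1..d})"
    and "\<And>b. b < d \<Longrightarrow> \<delta> (Y (Suc b)) = (if cell_pos (map fst cs) b > 0 then Y b else 0)"
proof -
  let ?A = "matrix_on_KX d \<delta>" and ?J = "jordan_matrix cs" and ?ss = "map fst cs"
  have dimA: "?A \<in> carrier_mat d d" by (simp add: matrix_on_KX_def)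
  obtain P Q where wit: "similar_mat_wit ?A ?J P Q" and nz: "0 \<notin> set ?ss"
    using jnf unfolding jordan_nf_def similar_mat_def by auto
  then have P: "P \<in> carrier_mat d d" and Q: "Q \<in> carrier_mat d d" and J: "?J \<in> carrier_mat d d"
    and PQ: "P * Q = 1\<^sub>m d" and QP: "Q * P = 1\<^sub>m d" and A: "?A = P * ?J * Q"
    using dimA unfolding similar_mat_wit_def Let_def by auto
  have size: "sum_list ?ss = d" using J jordan_matrix_dim(1)[of cs] by auto
  have AP: "?A * P = P * ?J"
  proof -
    have "?A * P = P * ?J * (Q * P)" unfolding A using P Q J by (simp add: assoc_mult_mat[of _ d d _ d _ d])
    then show ?thesis by (simp only: QP right_mult_one_mat[OF mult_carrier_mat[OF P J]])
  qed
  let ?Y = "column_vectors d P" and ?Y' = "column_vectors d Q" and ?eig = "cell_eigenvalue cs"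
  have inv: "free_hom ?Y (?Y' j) = gen j" "free_hom ?Y' (?Y j) = gen j" for j
    using free_hom_column_vectors[OF P Q PQ] free_hom_column_vectors[OF Q P QP] by auto
  have op: "linear_operator_on (free_algebra p d) \<delta>"
    using \<delta> unfolding linear_derivation_def derivation_def by blast
  have genY: "gen (Suc i) \<in> free_algebra p d" if "i < d" for i
    using that by (auto simp: free_algebra_def gen_eq_unit magma_Gen_iff)
  have jordan: "\<delta> (?Y (Suc b)) = scale (?eig b) (?Y (Suc b)) + (if cell_pos ?ss b > 0 then ?Y b else 0)"
    if b: "b < d" for b
  proof -
    have "\<delta> (?Y (Suc b)) = (\<Sum>i<d. scale (P $$ (i, b)) (\<delta> (gen (Suc i))))"
      unfolding column_vectors_Suc[OF b] using genY by (intro linear_operator_on_sum[OF op]) auto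
    also have "\<dots> = (\<Sum>i<d. scale (P $$ (i, b)) (column_vectors d ?A (Suc i)))"
      by (simp add: derivation_on_generators[OF \<delta>] column_vectors_Suc)
    also have "\<dots> = (\<Sum>i<d. scale (?J $$ (i, b)) (?Y (Suc i)))"
      by (simp only: combine_column_vectors[OF dimA P b] combine_column_vectors[OF P J b] AP)
    also have "\<dots> = (\<Sum>i<d. (if i = b then scale (?eig b) (?Y (Suc b)) else 0) +
        (if Suc i = b then (if cell_pos ?ss b > 0 then ?Y b else 0) else 0))"
      using b size by (intro sum.cong refl) (auto simp: jordan_matrix_index[OF nz])
    also have "\<dots> = scale (?eig b) (?Y (Suc b)) +
        (\<Sum>i<d. if Suc i = b then (if cell_pos ?ss b > 0 then ?Y b else 0) else 0)"
      using b by (simp add: sum.distrib)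
    also have "(\<Sum>i<d. if Suc i = b then (if cell_pos ?ss b > 0 then ?Y b else 0) else 0) =
        (if cell_pos ?ss b > 0 then ?Y b else 0)"
    proof (cases b)
      case 0
      then show ?thesis using cell_pos_0[OF nz] by simp
    qed (use b in simp)
    finally show ?thesis .
  qed
  have Y_free: "?Y (Suc b) \<in> free_algebra p d" if "b < d" for b
    using column_vectors_supported[of "Suc b" d P] that
    by (auto simp: free_algebra_def magma_Gen_iff subset_iff)
  have eig_first: "?eig b = 0" if b: "b < d" and first: "cell_pos ?ss b = 0" for b
  proof -
    obtain N where N: "(\<delta> ^^ N) (?Y (Suc b)) = 0"
      using nilpotent Y_free[OF b] unfolding locally_nilpotent_def by blast
    have "(\<delta> ^^ N) (?Y (Suc b)) = scale (?eig b ^ N) (?Y (Suc b))" for N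
    proof (induction N)
      case (Suc N)
      then show ?case
        using jordan[OF b] first op Y_free[OF b] unfolding linear_operator_on_def by (simp add: mult.commute)
    qed simp
    moreover have "?Y (Suc b) \<noteq> 0"
    proof
      assume "?Y (Suc b) = 0"
      then have "gen (Suc b) = (0 :: expr \<Rightarrow>\<^sub>0 'k)"
        using inv(2)[of "Suc b"] linear_map_hom[OF linear_free_hom[of ?Y']] by (simp add: module_hom.zero)
      then have "Poly_Mapping.lookup (gen (Suc b) :: expr \<Rightarrow>\<^sub>0 'k) (Gen (Suc b)) = 0" by simp
      then show False by (simp add: gen_def)
    qed
    ultimately show ?thesis using N by simp
  qed
  have eig: "?eig b = 0" if "b < d" for b
    using that
  proof (induction "cell_pos ?ss b" arbitrary: b)
    case 0
    then show ?case using eig_first by simp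
  next
    case (Suc q)
    then have pos: "cell_pos ?ss b > 0" by simp
    show ?case
      using Suc.hyps(1)[of "b - 1"] Suc.hyps(2) Suc.prems cell_previous(2)[OF nz pos]
        cell_eigenvalue_previous[OF nz pos]
      by simp
  qed
  show thesis
    by (rule that[of ?Y ?Y'])
       (use size inv column_vectors_supported jordan eig in \<open>simp_all del: One_nat_def\<close>)
qed

section \<open>The \<open>sl\<^sub>2\<close>-triple of a list of Jordan cells\<close>

text \<open>Generators are numbered from 1 and positions from 0, so the generator \<open>j\<close> sits at the index
  \<open>j - 1\<close>. The values outside the range are 0, which makes the commutation relation below hold for
  every generator.\<close>

definition cell_weight :: "nat list \<Rightarrow> nat \<Rightarrow> int" where
  "cell_weight ss j =
     (if j \<in> {1..sum_list ss} then int (cell_top ss (j - 1)) - 2 * int (cell_pos ss (j - 1)) else 0)"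

definition raise :: "nat list \<Rightarrow> nat \<Rightarrow> (expr \<Rightarrow>\<^sub>0 'k::field)" where
  "raise ss j = (if j \<in> {1..sum_list ss} \<and> cell_pos ss (j - 1) > 0 then gen (j - 1) else 0)"

text \<open>In position \<open>q\<close> of a cell with last position \<open>t\<close> the coefficient is \<open>(q + 1) (t - q)\<close>: its increment
  from \<open>q - 1\<close> to \<open>q\<close> is the weight \<open>t - 2 q\<close>, and it vanishes at \<open>q = t\<close>, where there is no next
  vector.\<close>

definition lower :: "nat list \<Rightarrow> nat \<Rightarrow> (expr \<Rightarrow>\<^sub>0 'k::field)" where
  "lower ss j = (if j \<in> {1..sum_list ss}
     then scale (of_nat ((cell_pos ss (j - 1) + 1) * (cell_top ss (j - 1) - cell_pos ss (j - 1)))) (gen (Suc j))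
     else 0)"

lemma raise_graded:
  assumes nz: "0 \<notin> set ss" and "j \<in> {1..sum_list ss}"
  shows "raise ss j \<in> supported {Gen j' |j'. j' \<in> {1..sum_list ss} \<and> cell_weight ss j' = cell_weight ss j + 2}"
proof -
  obtain b where b: "j = Suc b" "b < sum_list ss" using assms(2) by (cases j) auto
  show ?thesis
  proof (cases "cell_pos ss b > 0")
    case True
    have "b \<in> {1..sum_list ss}" using cell_previous(1)[OF nz True] b by auto
    moreover have "cell_weight ss b = cell_weight ss j + 2"
      using cell_previous[OF nz True] b by (simp add: cell_weight_def)
    ultimately show ?thesis using b True by (simp add: raise_def gen_eq_unit)
  qed (use b in \<open>simp add: raise_def\<close>)
qed

lemma lower_graded:
  assumes "j \<in> {1..sum_list ss}"
  shows "lower ss j \<in> supported {Gen j' |j'. j' \<in> {1..sum_list ss} \<and> cell_weight ss j' = cell_weight ss j + - 2}"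
proof -
  obtain b where b: "j = Suc b" "b < sum_list ss" using assms by (cases j) auto
  show ?thesis
  proof (cases "cell_pos ss b < cell_top ss b")
    case True
    have "Suc j \<in> {1..sum_list ss}" using cell_next(1)[OF True] b by auto
    moreover have "cell_weight ss (Suc j) = cell_weight ss j + - 2"
      using cell_next[OF True] b by (simp add: cell_weight_def)
    ultimately have "gen (Suc j) \<in> supported {Gen j' |j'. j' \<in> {1..sum_list ss} \<and> cell_weight ss j' = cell_weight ss j + - 2}"
      by (simp add: gen_eq_unit)
    then show ?thesis unfolding lower_def using assms
      by (simp only: if_True, intro kspace.subspace_scale subspace_supported)
  next
    case False
    then show ?thesis using b by (simp add: lower_def)
  qed
qed

lemma raise_lower_commutator:
  assumes nz: "0 \<notin> set ss"
  shows "free_derivation (raise ss) (lower ss j) - free_derivation (lower ss) (raise ss j) =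
    (scale (of_int (cell_weight ss j)) (gen j) :: expr \<Rightarrow>\<^sub>0 'k::field)"
proof -
  interpret D: Vector_Spaces.linear scale scale "free_derivation a" for a :: "nat \<Rightarrow> expr \<Rightarrow>\<^sub>0 'k" by (rule linear_free_derivation)
  show ?thesis
  proof (cases "j \<in> {1..sum_list ss}")
    case True
    then obtain b where b: "j = Suc b" "b < sum_list ss" by (cases j) auto
    define q r where "q = cell_pos ss b" and "r = cell_top ss b - cell_pos ss b"
    have top: "cell_top ss b = q + r" using cell_pos_le_top[of ss b] by (simp add: q_def r_def)
    have raise_lower: "free_derivation (raise ss) (lower ss j) = (scale (of_nat ((q + 1) * r)) (gen j) :: expr \<Rightarrow>\<^sub>0 'k)"
    proof (cases "r = 0")
      case False
      then have "cell_pos ss b < cell_top ss b" by (simp add: r_def)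
      note nxt = cell_next[OF this]
      show ?thesis using b nxt by (simp add: lower_def D.scale raise_def q_def r_def)
    qed (use b top q_def in \<open>simp add: lower_def D.scale\<close>)
    have lower_raise: "free_derivation (lower ss) (raise ss j) = (scale (of_nat (q * (r + 1))) (gen j) :: expr \<Rightarrow>\<^sub>0 'k)"
    proof (cases "q > 0")
      case True
      then have "cell_pos ss b > 0" by (simp add: q_def)
      note prev = cell_previous[OF nz this]
      have "b \<in> {1..sum_list ss}" using prev(1) b by auto
      moreover have "cell_pos ss (b - 1) + 1 = q" "cell_top ss (b - 1) - cell_pos ss (b - 1) = r + 1"
        using prev top by (auto simp: q_def)
      ultimately show ?thesis using b True by (simp add: lower_def raise_def q_def)
    qed (use b q_def in \<open>simp add: raise_def D.zero\<close>)
    have difference: "(of_nat ((q + 1) * r) - of_nat (q * (r + 1)) :: 'k) = of_int (cell_weight ss j)"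
      using b top by (simp add: cell_weight_def q_def[symmetric] algebra_simps)
    show ?thesis
      unfolding raise_lower lower_raise difference[symmetric] by (rule kspace.scale_left_diff_distrib[symmetric])
  qed (auto simp: lower_def raise_def cell_weight_def D.zero)
qed

text \<open>The commutator of the two derivations and the diagonal derivation with the weights as eigenvalues
  agree on the generators, hence everywhere.\<close>

lemma sl2_action_free_algebra:
  fixes m :: nat
  assumes nz: "0 \<notin> set ss"
  shows "sl2_action (free_derivation (raise ss) :: (expr \<Rightarrow>\<^sub>0 'k::field_char_0) \<Rightarrow> _) (free_derivation (lower ss))
    (weight (cell_weight ss)) {u \<in> magma p (sum_list ss). deg u = m}"
proof (rule sl2_action.intro)
  let ?B = "{u \<in> magma p (sum_list ss). deg u = m}" and ?g = "cell_weight ss"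
  let ?e = "free_derivation (raise ss) :: (expr \<Rightarrow>\<^sub>0 'k) \<Rightarrow> _"
    and ?f = "free_derivation (lower ss) :: (expr \<Rightarrow>\<^sub>0 'k) \<Rightarrow> _"
  show "finite ?B" by (rule finite_degree_eq)
  show "linear_map ?e" "linear_map ?f"
    by (rule linear_free_derivation)+
  fix u assume u: "u \<in> ?B"
  show "?e (unit_vec u) \<in> supported {x \<in> ?B. weight ?g x = weight ?g u + 2}"
    using free_derivation_graded[where a = "raise ss" and g = ?g and c = 2, OF raise_graded[OF nz], of u p] u by auto
  show "?f (unit_vec u) \<in> supported {x \<in> ?B. weight ?g x = weight ?g u - 2}"
    using free_derivation_graded[where a = "lower ss" and g = ?g and c = "- 2", OF lower_graded, of u p] u by auto
  have "?e (?f v) - ?f (?e v) = free_derivation (\<lambda>j. scale (of_int (?g j)) (gen j)) v" for v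
    by (rule leibniz_eqI[where D = "\<lambda>v. ?e (?f v) - ?f (?e v)"])
       (simp_all add: leibniz_commutator leibniz_free_derivation raise_lower_commutator[OF nz])
  then show "?e (?f (unit_vec u)) - ?f (?e (unit_vec u)) = scale (of_int (weight ?g u)) (unit_vec u)"
    by (simp add: free_derivation_weight)
qed

text \<open>The automorphism \<^term>\<open>free_hom Y\<close> carries the derivation that moves the generators along the
  cells into \<open>\<delta>\<close> and preserves degrees. It maps the kernel of the former, which the \<open>sl\<^sub>2\<close>-action
  describes, onto the constants of \<open>\<delta>\<close>.\<close>

lemma dim_constants:
  fixes \<delta> :: "(expr \<Rightarrow>\<^sub>0 'k::field_char_0) \<Rightarrow> (expr \<Rightarrow>\<^sub>0 'k)"
  assumes \<delta>: "linear_derivation p d \<delta>" and nilpotent: "locally_nilpotent p d \<delta>"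
    and jnf: "jordan_nf (matrix_on_KX d \<delta>) cs"
  defines "ss \<equiv> map fst cs"
  shows "sum_list ss = d"
    and "kspace.dim (constants p d \<delta> \<inter> homogeneous m) =
      card {u \<in> magma p d. deg u = m \<and> weight (cell_weight ss) u = 0} +
      card {u \<in> magma p d. deg u = m \<and> weight (cell_weight ss) u = 1}"
    and "card {u \<in> magma p d. deg u = m \<and> weight (cell_weight ss) u = - 1} =
      card {u \<in> magma p d. deg u = m \<and> weight (cell_weight ss) u = 1}"
proof -
  obtain Y Y' :: "nat \<Rightarrow> (expr \<Rightarrow>\<^sub>0 'k)" where size: "sum_list ss = d"
    and YY': "\<And>j. free_hom Y (Y' j) = gen j" and Y'Y: "\<And>j. free_hom Y' (Y j) = gen j"
    and Y: "\<And>j. j \<in> {1..d} \<Longrightarrow> Y j \<in> supported (Gen ` {1..d})"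
    and Y': "\<And>j. j \<in> {1..d} \<Longrightarrow> Y' j \<in> supported (Gen ` {1..d})"
    and \<delta>Y: "\<And>b. b < d \<Longrightarrow> \<delta> (Y (Suc b)) = (if cell_pos ss b > 0 then Y b else 0)"
    using jordan_basis[OF \<delta> nilpotent jnf] unfolding ss_def by blast
  show "sum_list ss = d" by (rule size)
  have nz: "0 \<notin> set ss" using jnf unfolding jordan_nf_def ss_def by simp
  let ?B = "{u \<in> magma p d. deg u = m}"
  let ?e = "free_derivation (raise ss) :: (expr \<Rightarrow>\<^sub>0 'k) \<Rightarrow> _"
  interpret sl2_action ?e "free_derivation (lower ss)" "weight (cell_weight ss)" ?B
    using sl2_action_free_algebra[OF nz, of p m] size by simp
  interpret h: Vector_Spaces.linear scale scale "free_hom Y" by (rule linear_free_hom)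
  have op: "linear_operator_on (free_algebra p d) \<delta>"
    and leib: "\<And>n i vs. (n, i) \<in> symbols p \<Longrightarrow> length vs = n \<Longrightarrow> set vs \<subseteq> free_algebra p d \<Longrightarrow>
      \<delta> (operation n i vs) = (\<Sum>j<n. operation n i (vs[j := \<delta> (vs ! j)]))"
    using \<delta> unfolding linear_derivation_def derivation_def by auto
  have hom_magma: "free_hom Y (unit_vec u) \<in> free_algebra p d" if "u \<in> magma p d" for u
    using free_hom_graded[where M = Y and d = d, OF Y that] by (auto simp: free_algebra_def)
  have \<delta>_unit: "\<delta> (free_hom Y (unit_vec u)) = free_hom Y (?e (unit_vec u))" if "u \<in> magma p d" for u
    using that
  proof (induction u rule: magma.induct)
    case (gen j)
    then obtain b where "j = Suc b" "b < d" by (cases j) auto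
    then show ?case
      using \<delta>Y[of b] size by (simp add: gen_eq_unit[symmetric] raise_def h.zero)
  next
    case (op n i us)
    let ?vs = "map (\<lambda>u. free_hom Y (unit_vec u)) us"
    have "\<delta> (free_hom Y (unit_vec (Op n i us))) = \<delta> (operation n i ?vs)"
      by (simp add: operation_units[symmetric] free_hom_operation o_def)
    also have "\<dots> = (\<Sum>j<n. operation n i (?vs[j := \<delta> (?vs ! j)]))"
      using op hom_magma by (intro leib) auto
    also have "\<dots> = (\<Sum>j<n. free_hom Y (operation n i ((map unit_vec us)[j := ?e (unit_vec (us ! j))])))"
    proof (rule sum.cong)
      fix j assume "j \<in> {..<n}"
      then have "\<delta> (?vs ! j) = free_hom Y (?e (unit_vec (us ! j)))" using op(2,3) by auto
      then show "operation n i (?vs[j := \<delta> (?vs ! j)]) =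
          free_hom Y (operation n i ((map unit_vec us)[j := ?e (unit_vec (us ! j))]))"
        by (simp add: free_hom_operation map_update o_def)
    qed simp
    also have "\<dots> = free_hom Y (?e (operation n i (map unit_vec us)))"
    proof -
      have "?e (operation n i (map unit_vec us)) =
          (\<Sum>j<length us. operation n i ((map unit_vec us)[j := ?e (map unit_vec us ! j)]))"
        using leibniz_free_derivation[of "raise ss :: nat \<Rightarrow> expr \<Rightarrow>\<^sub>0 'k"] unfolding leibniz_def by simp
      then show ?thesis using op(2) by (simp add: h.sum)
    qed
    finally show ?case by (simp add: operation_units)
  qed
  have intertwine: "\<delta> (free_hom Y v) = free_hom Y (?e v)" if v: "v \<in> supported (magma p d)" for v
  proof -
    have "\<delta> (free_hom Y v) = \<delta> (\<Sum>u\<in>Poly_Mapping.keys v. scale (Poly_Mapping.lookup v u) (free_hom Y (unit_vec u)))"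
      by (subst linear_map_expand[OF linear_free_hom, of Y v]) simp
    also have "\<dots> = (\<Sum>u\<in>Poly_Mapping.keys v. scale (Poly_Mapping.lookup v u) (\<delta> (free_hom Y (unit_vec u))))"
      using v hom_magma by (intro linear_operator_on_sum[OF op]) auto
    also have "\<dots> = (\<Sum>u\<in>Poly_Mapping.keys v. scale (Poly_Mapping.lookup v u) (free_hom Y (?e (unit_vec u))))"
      using v \<delta>_unit by (intro sum.cong) auto
    also have "\<dots> = free_hom Y (?e v)"
      by (subst linear_map_expand[OF linear_free_derivation, of "raise ss" v])
         (simp add: linear_map_sum[OF linear_free_hom])
    finally show ?thesis .
  qed
  have graded: "free_hom M v \<in> supported ?B"
    if M: "\<And>j. j \<in> {1..d} \<Longrightarrow> M j \<in> supported (Gen ` {1..d})" and v: "v \<in> supported ?B"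
    for M and v :: "expr \<Rightarrow>\<^sub>0 'k"
  proof (rule linear_map_supportedI[OF linear_free_hom subspace_supported _ v])
    fix u assume "u \<in> ?B"
    then show "free_hom M (unit_vec u) \<in> supported ?B" using free_hom_graded[where M = M and d = d, OF M, of u p] by auto
  qed
  have inverse: "free_hom Y (free_hom Y' v) = v" "free_hom Y' (free_hom Y v) = v" for v
    using free_hom_inverse[of Y Y', OF YY'] free_hom_inverse[of Y' Y, OF Y'Y] by auto
  let ?K = "{v \<in> supported ?B. ?e v = 0}"
  have "constants p d \<delta> \<inter> homogeneous m = {v \<in> supported ?B. \<delta> v = 0}"
    unfolding constants_def free_algebra_def homogeneous_def by auto
  also have "\<dots> = free_hom Y ` ?K"
  proof (intro equalityI subsetI)
    fix v assume v: "v \<in> {v \<in> supported ?B. \<delta> v = 0}"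
    let ?w = "free_hom Y' v"
    have w: "?w \<in> supported ?B" using graded[where M = Y', OF Y'] v by blast
    then have "?w \<in> supported (magma p d)" by auto
    then have "free_hom Y (?e ?w) = 0" using intertwine[of ?w] v by (simp add: inverse)
    then have "?e ?w = 0" using inverse(2)[of "?e ?w"] linear_map_hom[OF linear_free_hom] module_hom.zero by metis
    then show "v \<in> free_hom Y ` ?K" using w inverse(1)[of v] by (intro image_eqI[of _ _ ?w]) auto
  next
    fix v assume "v \<in> free_hom Y ` ?K"
    then obtain w where w: "w \<in> supported ?B" "?e w = 0" "v = free_hom Y w" by blast
    then have "\<delta> v = 0" using intertwine[of w] by (auto simp: h.zero)
    moreover have "v \<in> supported ?B" using graded[where M = Y, OF Y w(1)] w(3) by simp
    ultimately show "v \<in> {v \<in> supported ?B. \<delta> v = 0}" by blast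
  qed
  finally have "kspace.dim (constants p d \<delta> \<inter> homogeneous m) = kspace.dim (free_hom Y ` ?K)" by simp
  also have "\<dots> = kspace.dim ?K"
  proof (rule dim_injective_image[OF linear_free_hom])
    show "kspace.subspace ?K"
      using kspace.subspace_inter[OF subspace_supported e.subspace_kernel, of ?B] by (simp add: Int_def)
    show "inj_on (free_hom Y) ?K" by (rule inj_on_inverseI[of _ "free_hom Y'"]) (rule inverse)
  qed
  finally show "kspace.dim (constants p d \<delta> \<inter> homogeneous m) =
      card {u \<in> magma p d. deg u = m \<and> weight (cell_weight ss) u = 0} +
      card {u \<in> magma p d. deg u = m \<and> weight (cell_weight ss) u = 1}"
    using dim_kernel by (simp add: conj_assoc)
  show "card {u \<in> magma p d. deg u = m \<and> weight (cell_weight ss) u = - 1} =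
      card {u \<in> magma p d. deg u = m \<and> weight (cell_weight ss) u = 1}"
    using card_weight_minus_one by (simp add: conj_assoc)
qed

section \<open>Extracting weights by integration\<close>

definition character :: "int \<Rightarrow> real \<Rightarrow> complex" where
  "character w u = exp (of_int w * (2 * of_real pi * \<i> * of_real u))"

lemma character_add: "character (v + w) u = character v u * character w u"
  by (simp add: character_def exp_add[symmetric] algebra_simps)

lemma character_0 [simp]: "character 0 u = 1"
  by (simp add: character_def)

lemma character_integral:
  "(character w has_integral (if w = 0 then 1 else 0)) {0..1}"
proof (cases "w = 0")
  case True
  have "character 0 = (\<lambda>u. 1)" by (rule ext) simp
  then show ?thesis using True has_integral_const_real[of "1::complex" 0 1] by simp
next
  case False
  define c where "c = of_int w * (2 * of_real pi * \<i>)"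
  have c: "c \<noteq> 0" using False by (simp add: c_def)
  have eq: "character w = (\<lambda>u. exp (c * of_real u))"
    by (rule ext) (simp add: character_def c_def algebra_simps)
  have "((\<lambda>z. exp (c * z) / c) has_field_derivative exp (c * z)) (at z)" for z
    using c by (auto intro!: derivative_eq_intros)
  then have "((\<lambda>u. exp (c * of_real u) / c) has_vector_derivative exp (c * of_real u)) (at u within {0..1})" for u :: real
    by (rule has_vector_derivative_real_field)
  then have "((\<lambda>u. exp (c * of_real u)) has_integral exp (c * of_real 1) / c - exp (c * of_real 0) / c) {0..1}"
    by (intro fundamental_theorem_of_calculus) auto
  moreover have "exp c = 1"
    unfolding c_def by (subst exp_eq_1) (auto intro!: exI[of _ w])
  ultimately show ?thesis using False by (simp add: eq)
qed

lemma cos_squared_eq_characters: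
  "complex_of_real ((cos (pi * u))\<^sup>2) = 1 / 2 + character 1 u / 4 + character (- 1) u / 4"
proof -
  have "cos (2 * (pi * u)) = 2 * (cos (pi * u))\<^sup>2 - 1" by (rule cos_double_cos)
  then have "complex_of_real ((cos (pi * u))\<^sup>2) = (1 + complex_of_real (cos (2 * pi * u))) / 2"
    by (simp add: mult.assoc)
  also have "complex_of_real (cos (2 * pi * u)) = (character 1 u + character (- 1) u) / 2"
    by (simp add: cos_of_real[symmetric] cos_exp_eq character_def mult_ac)
  finally show ?thesis by (simp add: field_simps)
qed

text \<open>The product of \<open>cos\<^sup>2 (\<pi> u)\<close> with the character of weight \<open>w\<close> is a combination of the characters
  of weights \<open>w\<close>, \<open>w + 1\<close> and \<open>w - 1\<close>, of which only a trivial one has a nonzero integral.\<close>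

lemma cos_squared_integral:
  fixes wt :: "'b \<Rightarrow> int"
  assumes B: "finite B"
  shows "((\<lambda>u. complex_of_real ((cos (pi * u))\<^sup>2) * (\<Sum>x\<in>B. character (wt x) u)) has_integral
    of_nat (card {x \<in> B. wt x = 0}) / 2 + of_nat (card {x \<in> B. wt x = - 1}) / 4 +
    of_nat (card {x \<in> B. wt x = 1}) / 4) {0..1}"
proof -
  let ?I = "\<lambda>w. if w = 0 then 1 else (0 :: complex)"
  have split: "complex_of_real ((cos (pi * u))\<^sup>2) * (\<Sum>x\<in>B. character (wt x) u) =
      (\<Sum>x\<in>B. character (wt x) u / 2 + character (wt x + 1) u / 4 + character (wt x - 1) u / 4)" for u
    unfolding cos_squared_eq_characters sum_distrib_left
    by (intro sum.cong refl) (simp add: character_add character_add[of "wt _" "- 1", simplified] field_simps)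
  have "((\<lambda>u. character w u / 2 + character (w + 1) u / 4 + character (w - 1) u / 4) has_integral
      ?I w / 2 + ?I (w + 1) / 4 + ?I (w - 1) / 4) {0..1}" for w
    by (intro has_integral_add has_integral_divide character_integral)
  then have "((\<lambda>u. \<Sum>x\<in>B. character (wt x) u / 2 + character (wt x + 1) u / 4 + character (wt x - 1) u / 4)
      has_integral (\<Sum>x\<in>B. ?I (wt x) / 2 + ?I (wt x + 1) / 4 + ?I (wt x - 1) / 4)) {0..1}"
    by (intro has_integral_sum B) auto
  moreover have "(\<Sum>x\<in>B. ?I (wt x + v)) = of_nat (card {x \<in> B. wt x = - v})" for v
  proof -
    have "(\<Sum>x\<in>B. ?I (wt x + v)) = (\<Sum>x\<in>B. if wt x = - v then 1 else 0)"
      by (intro sum.cong) auto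
    then show ?thesis using B by (simp add: sum.inter_filter[symmetric])
  qed
  from this[of 0] this[of 1] this[of "- 1"]
  have "(\<Sum>x\<in>B. ?I (wt x) / 2 + ?I (wt x + 1) / 4 + ?I (wt x - 1) / 4) =
      of_nat (card {x \<in> B. wt x = 0}) / 2 + of_nat (card {x \<in> B. wt x = - 1}) / 4 +
      of_nat (card {x \<in> B. wt x = 1}) / 4"
    by (simp only: sum.distrib sum_divide_distrib[symmetric] add_0_right diff_conv_add_uminus minus_zero minus_minus)
  ultimately show ?thesis by (simp only: split)
qed

section \<open>Schur functions and the Hilbert series\<close>

lemma schur_eq_characters:
  "schur n (exp (2 * pi * \<i> * u)) (exp (- 2 * pi * \<i> * u)) = (\<Sum>j<Suc n. character (int n - 2 * int j) u)"
  unfolding schur_def lessThan_Suc_atMost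
proof (rule sum.cong)
  fix j assume "j \<in> {..n}"
  then show "exp (2 * pi * \<i> * u) ^ (n - j) * exp (- 2 * pi * \<i> * u) ^ j = character (int n - 2 * int j) u"
    by (simp add: character_def exp_of_nat_mult[symmetric] exp_add[symmetric] of_nat_diff algebra_simps)
qed simp

text \<open>Both sides are \<open>(x ^ (n + 1) - y ^ (n + 1)) / (x - y)\<close> for \<open>x = exp (2 \<pi> i u)\<close> and \<open>y = 1 / x\<close>.\<close>

lemma schur_eq_sin_quotient:
  assumes "sin (2 * pi * u) \<noteq> 0"
  shows "schur n (exp (2 * pi * \<i> * u)) (exp (- 2 * pi * \<i> * u)) = complex_of_real (sin_quotient n u)"
proof -
  let ?\<theta> = "2 * pi * u"
  let ?x = "exp (2 * pi * \<i> * u)" and ?y = "exp (- 2 * pi * \<i> * u)"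
  have sine: "?x ^ m - ?y ^ m = 2 * \<i> * complex_of_real (sin (real m * ?\<theta>))" for m
  proof -
    have "2 * \<i> * sin z = exp (\<i> * z) - exp (- (\<i> * z))" for z :: complex
      by (simp add: sin_exp_eq)
    from this[of "complex_of_real (real m * ?\<theta>)"] show ?thesis
      by (simp add: sin_of_real[symmetric] exp_of_nat_mult[symmetric] mult_ac)
  qed
  have "(?x - ?y) * schur n ?x ?y = ?x ^ Suc n - ?y ^ Suc n"
    using power_diff_sumr2[of ?y "Suc n" ?x]
    by (simp add: schur_def lessThan_Suc_atMost algebra_simps)
  then have "2 * \<i> * complex_of_real (sin ?\<theta>) * schur n ?x ?y = 2 * \<i> * complex_of_real (sin (real (Suc n) * ?\<theta>))"
    using sine[of 1] sine[of "Suc n"] by simp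
  then have "complex_of_real (sin ?\<theta>) * schur n ?x ?y = complex_of_real (sin (real (Suc n) * ?\<theta>))"
    by simp
  then have "schur n ?x ?y = complex_of_real (sin (real (Suc n) * ?\<theta>)) / complex_of_real (sin ?\<theta>)"
    using assms by (simp add: field_simps)
  also have "\<dots> = complex_of_real (sin_quotient n u)"
    using assms by (simp add: sin_quotient_def mult_ac)
  finally show ?thesis .
qed

lemma sin_2pi_eq_0:
  assumes "u \<in> {0..1}" "sin (2 * pi * u) = 0"
  shows "u \<in> {0, 1 / 2, 1}"
proof -
  obtain i :: int where "2 * pi * u = of_int i * pi" using assms(2) sin_zero_iff_int2 by blast
  then have i: "2 * u = of_int i" by simp
  then have "0 \<le> (of_int i :: real)" "(of_int i :: real) \<le> 2" using assms(1) by auto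
  then have "0 \<le> i" "i \<le> 2" by linarith+
  then have "i = 0 \<or> i = 1 \<or> i = 2" by auto
  then show ?thesis using i by auto
qed

lemma sum_character_cell_weight:
  assumes ss: "ss = map (\<lambda>r. n r + 1) [1..<Suc k]"
  shows "(\<Sum>j=1..sum_list ss. character (cell_weight ss j) u) =
    (\<Sum>r=1..k. schur (n r) (exp (2 * pi * \<i> * u)) (exp (- 2 * pi * \<i> * u)))"
proof -
  let ?F = "\<lambda>t q. character (int t - 2 * int q) u"
  have "(\<Sum>j=1..sum_list ss. character (cell_weight ss j) u) =
      (\<Sum>j=1..sum_list ss. ?F (cell_top ss (j - 1)) (cell_pos ss (j - 1)))"
    by (intro sum.cong) (auto simp: cell_weight_def)
  also have "\<dots> = (\<Sum>b<sum_list ss. ?F (cell_top ss b) (cell_pos ss b))"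
    by (simp add: sum.atLeast1_atMost_eq)
  also have "\<dots> = (\<Sum>s\<leftarrow>ss. \<Sum>j<s. ?F (s - 1) j)" by (rule sum_over_cells)
  also have "\<dots> = (\<Sum>r\<leftarrow>[1..<Suc k]. \<Sum>j<Suc (n r). character (int (n r) - 2 * int j) u)"
    unfolding ss by (simp add: o_def)
  also have "\<dots> = (\<Sum>r=1..k. \<Sum>j<Suc (n r). character (int (n r) - 2 * int j) u)"
    by (simp only: interv_sum_list_conv_sum_set_nat set_upt atLeastLessThanSuc_atLeastAtMost)
  finally show ?thesis by (simp only: schur_eq_characters)
qed

lemma hilbert_series_free_algebra_nth:
  "fps_nth (hilbert_series (free_algebra p d :: (expr \<Rightarrow>\<^sub>0 'k::field) set)) m =
    (if m \<ge> 1 then of_nat (card {u \<in> magma p d. deg u = m}) else 0)"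
proof -
  have "(free_algebra p d \<inter> homogeneous m :: (expr \<Rightarrow>\<^sub>0 'k) set) = supported {u \<in> magma p d. deg u = m}"
    by (auto simp: free_algebra_def homogeneous_def)
  then show ?thesis by (simp add: hilbert_series_def dim_supported)
qed

lemma nth_compose_X_const:
  "fps_nth (fps_compose a (fps_X * fps_const c)) m = fps_nth a m * (c :: 'a::comm_ring_1) ^ m"
  using fps_compose_linear[of a c] by (simp add: mult.commute)

text \<open>Half of the coefficient of \<open>z ^ m\<close>. The cells contribute the weights \<open>t, t - 2, \<dots>, - t\<close>, which are
  the exponents in the Schur function; the weights 1 and -1 occur equally often, so their two
  quarters add up to half the number of expressions of weight 1.\<close>

lemma coefficient_integral:
  fixes \<delta> :: "(expr \<Rightarrow>\<^sub>0 'k::field_char_0) \<Rightarrow> (expr \<Rightarrow>\<^sub>0 'k)"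
  assumes "linear_derivation p d \<delta>" and "locally_nilpotent p d \<delta>"
    and cells: "has_jordan_cells (matrix_on_KX d \<delta>) (map (\<lambda>r. n r + 1) [1..<Suc k])"
  shows "((\<lambda>u. complex_of_real ((cos (pi * u))\<^sup>2) * (of_nat (card {t \<in> magma p 1. deg t = m}) *
      (\<Sum>r=1..k. schur (n r) (exp (2 * pi * \<i> * u)) (exp (- 2 * pi * \<i> * u))) ^ m))
    has_integral of_nat (kspace.dim (constants p d \<delta> \<inter> homogeneous m)) / 2) {0..1}"
proof -
  obtain cs where jnf: "jordan_nf (matrix_on_KX d \<delta>) cs"
    and cs: "map fst cs = map (\<lambda>r. n r + 1) [1..<Suc k]"
    using cells unfolding has_jordan_cells_def by blast
  define ss where "ss = map fst cs"
  note dim = dim_constants[OF assms(1,2) jnf, folded ss_def]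
  let ?B = "{u \<in> magma p d. deg u = m}" and ?wt = "weight (cell_weight ss)"
  have gf: "(\<Sum>x\<in>?B. character (?wt x) u) = of_nat (card {t \<in> magma p 1. deg t = m}) *
      (\<Sum>r=1..k. schur (n r) (exp (2 * pi * \<i> * u)) (exp (- 2 * pi * \<i> * u))) ^ m" for u
    using weight_generating_function[where \<phi> = "\<lambda>w. character w u" and g = "cell_weight ss" and p = p and d = d and m = m]
      sum_character_cell_weight[of ss n k u] cs dim(1)
    by (simp add: character_add ss_def)
  have "of_nat (card {x \<in> ?B. ?wt x = 0}) / 2 + of_nat (card {x \<in> ?B. ?wt x = - 1}) / 4 +
      of_nat (card {x \<in> ?B. ?wt x = 1}) / 4 = (of_nat (kspace.dim (constants p d \<delta> \<inter> homogeneous m)) / 2 :: complex)"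
    using dim(2,3)[of m] by (simp add: conj_assoc field_simps)
  then show ?thesis
    using cos_squared_integral[OF finite_degree_eq[of p d m], of ?wt] unfolding gf by (simp only:)
qed

theorem theorem5p1:
  fixes p :: "nat \<Rightarrow> nat" and d k :: nat and n :: "nat \<Rightarrow> nat"
    and \<delta> :: "(expr \<Rightarrow>\<^sub>0 'k::field_char_0) \<Rightarrow> (expr \<Rightarrow>\<^sub>0 'k)"
  assumes "linear_derivation p d \<delta>"
    and "locally_nilpotent p d \<delta>"
    and "has_jordan_cells (matrix_on_KX d \<delta>) (map (\<lambda>r. n r + 1) [1..<Suc k])"
  shows "((hilbert_series (constants p d \<delta>) :: complex fps) =
           fps_const 2 * coeffwise_integral (\<lambda>u.
             fps_const (complex_of_real ((cos (pi * u))\<^sup>2)) *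
             H_delta TYPE('k) p k n (exp (2 * pi * \<i> * u)) (exp (- 2 * pi * \<i> * u)))) \<and>
         ((hilbert_series (constants p d \<delta>) :: real fps) =
           fps_const 2 * coeffwise_integral (\<lambda>u.
             fps_const ((cos (pi * u))\<^sup>2) *
             fps_compose (hilbert_series (free_algebra p 1 :: (expr \<Rightarrow>\<^sub>0 'k) set))
               (fps_X * fps_const (\<Sum>r=1..k. sin_quotient (n r) u))))"
proof (intro conjI fps_ext)
  fix m
  let ?dim = "kspace.dim (constants p d \<delta> \<inter> homogeneous m)"
  let ?c = "card {t \<in> magma p 1. deg t = m}"
  let ?S = "\<lambda>u. \<Sum>r=1..k. schur (n r) (exp (2 * pi * \<i> * u)) (exp (- 2 * pi * \<i> * u))"
  let ?R = "\<lambda>u. \<Sum>r=1..k. sin_quotient (n r) u"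
  have schur_integral: "((\<lambda>u. complex_of_real ((cos (pi * u))\<^sup>2) * (of_nat ?c * ?S u ^ m))
      has_integral of_nat ?dim / 2) {0..1}"
    by (rule coefficient_integral[OF assms])
  have double_schur_integral: "2 * integral {0..1} (\<lambda>u. complex_of_real ((cos (pi * u))\<^sup>2) * (of_nat ?c * ?S u ^ m)) =
      of_nat ?dim"
    by (simp only: integral_unique[OF schur_integral]) simp
  show "fps_nth (hilbert_series (constants p d \<delta>) :: complex fps) m =
      fps_nth (fps_const 2 * coeffwise_integral (\<lambda>u. fps_const (complex_of_real ((cos (pi * u))\<^sup>2)) *
        H_delta TYPE('k) p k n (exp (2 * pi * \<i> * u)) (exp (- 2 * pi * \<i> * u)))) m"
    using double_schur_integral
    by (simp add: coeffwise_integral_def H_delta_def nth_compose_X_const hilbert_series_free_algebra_nth)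
       (simp add: hilbert_series_def)
  \<comment> \<open>The sine vanishes at three points only, so its values there do not affect the integral.\<close>
  have "((\<lambda>u. complex_of_real ((cos (pi * u))\<^sup>2 * (of_nat ?c * ?R u ^ m)))
      has_integral of_nat ?dim / 2) {0..1}"
  proof (rule has_integral_spike_finite[OF _ _ schur_integral])
    show "finite {0, 1 / 2, 1 :: real}" by simp
    fix u :: real assume "u \<in> {0..1} - {0, 1 / 2, 1}"
    then have "sin (2 * pi * u) \<noteq> 0" using sin_2pi_eq_0[of u] by blast
    then have "?S u = complex_of_real (?R u)" using schur_eq_sin_quotient by simp
    then show "complex_of_real ((cos (pi * u))\<^sup>2 * (of_nat ?c * ?R u ^ m)) =
        complex_of_real ((cos (pi * u))\<^sup>2) * (of_nat ?c * ?S u ^ m)"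
      by (simp only: of_real_mult of_real_power of_real_of_nat_eq)
  qed
  from has_integral_linear[OF this bounded_linear_Re]
  have "((\<lambda>u. (cos (pi * u))\<^sup>2 * (of_nat ?c * ?R u ^ m)) has_integral of_nat ?dim / 2) {0..1}"
    by (simp add: o_def del: of_real_mult of_real_power of_real_sum)
  then have "2 * integral {0..1} (\<lambda>u. (cos (pi * u))\<^sup>2 * (of_nat ?c * ?R u ^ m)) = of_nat ?dim"
    by (simp only: integral_unique)
  then show "fps_nth (hilbert_series (constants p d \<delta>) :: real fps) m =
      fps_nth (fps_const 2 * coeffwise_integral (\<lambda>u. fps_const ((cos (pi * u))\<^sup>2) *
        fps_compose (hilbert_series (free_algebra p 1 :: (expr \<Rightarrow>\<^sub>0 'k) set))
          (fps_X * fps_const (?R u)))) m"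
    by (simp add: coeffwise_integral_def nth_compose_X_const hilbert_series_free_algebra_nth)
       (simp add: hilbert_series_def)
qed

end
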